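(* Let $G\subset \mathrm{PSL}(3,\mathbb C)$ be a discrete subgroup, and let $(g_n)\subset G$ be a sequence of pairwise distinct elements. Then, after passing to a subsequence, exactly one of the following mutually exclusive alternatives occurs: (1) (Full-flag case) There exist full flags $(p^{+},\ell^{+})$ and $(p^{-},\ell^{-})$ in $\mathbb P^2_{\mathbb C}$, with $p^{\pm}\in\ell^{\pm}$, such that $g_n$ converges locally uniformly on $\mathbb P^2_{\mathbb C}\setminus\ell^+$ to the constant map $p^-$, and $g_n^{-1}$ converges locally uniformly on $\mathbb P^2_{\mathbb C}\setminus\ell^-$ to the constant map $p^+$. Moreover, for every point $x\in\ell^+\setminus\{p^+\}$ the set of destinations of $x$ is $D_{(g_n)}(x)=\ell^-$. (2) (Point-to-line case) There exist a point $p^+\in\mathbb P^2_{\mathbb C}$ and a projective line $\ell^-\subset\mathbb P^2_{\mathbb C}$ such that $(g_n)$ converges locally uniformly on $\mathbb P^2_{\mathbb C}\setminus\{p^+\}$ to a pseudo-projective map with kernel $\{p^+\}$ and image $\ell^-$, while $(g_n^{-1})$ converges locally uniformly on $\mathbb P^2_{\mathbb C}\setminus\ell^-$ to the constant map $p^+$. (3) (Line-to-point case) There exist a projective line $\ell^+\subset\mathbb P^2_{\mathbb C}$ and a point $p^-\in\mathbb P^2_{\mathbb C}$ such that $(g_n)$ converges locally uniformly on $\mathbb P^2_{\mathbb C}\setminus\ell^+$ to the constant map $p^-$, while $(g_n^{-1})$ converges locally uniformly on $\mathbb P^2_{\mathbb C}\setminus\{p^-\}$ to a pseudo-projective map with kernel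 $\{p^-\}$ and image $\ell^+$.
   Context: $\mathrm{PSL}(3,\mathbb C)$ acts on the complex projective plane $\mathbb P^2_{\mathbb C}$ by projective transformations. A full flag is a pair $(p,\ell)$ with $p$ a point lying on the projective line $\ell$. Pseudo-projective maps: $\mathrm{SP}(3,\mathbb C):=(M_{3\times3}(\mathbb C)\setminus\{0\})/\mathbb C^*$. An element $S=[A]$ induces a map $S:\mathbb P^2_{\mathbb C}\setminus\mathrm{Ker}(S)\to\mathbb P^2_{\mathbb C}$, where $\mathrm{Ker}(S)$ is the projectivization of $\ker A$ (possibly empty), and its image is $\mathrm{Im}(S):=S(\mathbb P^2_{\mathbb C}\setminus \mathrm{Ker}(S))$. Destinations: for a sequence $(g_m)\subset\mathrm{PSL}(3,\mathbb C)$ and $x\in\mathbb P^2_{\mathbb C}$, the set of destinations is $D_{(g_m)}(x)=\{y : \exists\, x_m\to x,\ \exists\, m_j\to\infty \text{ such that } g_{m_j}(x_{m_j})\to y\}$. *)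

theory Defs
  imports "HOL-Analysis.Analysis" "HOL-Algebra.Coset"
begin

section \<open>The complex projective plane\<close>

definition proportional :: "complex^3 \<Rightarrow> complex^3 \<Rightarrow> bool"
  where "proportional v w \<longleftrightarrow> v \<noteq> 0 \<and> w \<noteq> 0 \<and> (\<exists>c. c \<noteq> 0 \<and> w = c *s v)"

lemma proportional_part_equivp: "part_equivp proportional"
proof (rule part_equivpI)
  show "\<exists>x. proportional x x"
    by (rule exI[of _ "axis 1 1"]) (auto simp: proportional_def axis_eq_0_iff intro!: exI[of _ 1])
  show "symp proportional"
  proof (rule sympI)
    fix v w assume "proportional v w"
    then obtain c where c: "v \<noteq> 0" "w \<noteq> 0" "c \<noteq> 0" "w = c *s v"
      by (auto simp: proportional_def)
    then have "v = inverse c *s w" by (simp add: vector_smult_assoc)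
    with c show "proportional w v"
      unfolding proportional_def by (metis inverse_nonzero_iff_nonzero)
  qed
  show "transp proportional"
  proof (rule transpI)
    fix u v w assume "proportional u v" "proportional v w"
    then show "proportional u w"
      unfolding proportional_def by (metis mult_eq_0_iff vector_smult_assoc)
  qed
qed

quotient_type cp2 = "complex^3" / partial: proportional
  morphisms rep_cp2 pt
  by (rule proportional_part_equivp)

lemma pt_eq_iff:
  assumes "v \<noteq> 0" "w \<noteq> 0"
  shows "pt v = pt w \<longleftrightarrow> (\<exists>c. c \<noteq> 0 \<and> w = c *s v)"
proof -
  have "proportional v v" "proportional w w"
    using assms by (auto simp: proportional_def intro!: exI[of _ 1])
  then have "pt v = pt w \<longleftrightarrow> proportional v w"
    using Quotient3_rel[OF Quotient3_cp2, of v w] by auto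
  with assms show ?thesis by (simp add: proportional_def)
qed

lemma rep_cp2_nonzero [simp]: "rep_cp2 x \<noteq> 0"
  using Quotient3_rep_reflp[OF Quotient3_cp2, of x] by (simp add: proportional_def)

lemma pt_rep_cp2 [simp]: "pt (rep_cp2 x) = x"
  by (rule Quotient3_abs_rep[OF Quotient3_cp2])

lemma cp2_cases: obtains v where "v \<noteq> 0" "x = pt v"
  by (metis rep_cp2_nonzero pt_rep_cp2)

lemma rep_cp2_pt:
  assumes "v \<noteq> 0"
  obtains c where "c \<noteq> 0" "rep_cp2 (pt v) = c *s v"
  using assms pt_eq_iff[of v "rep_cp2 (pt v)"] by auto

text \<open>
  The plane is metrized by embedding it into the matrices: a point goes to the orthogonal
  projection \<open>v v\<^sup>* / |v|\<^sup>2\<close> onto the line it spans.  The resulting distance is, up to the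
  factor \<open>sqrt 2\<close>, the sine of the Fubini--Study angle; \<open>open_cp2_iff\<close> below shows that its
  topology is the quotient topology.
\<close>

definition line_projection :: "complex^3 \<Rightarrow> complex^3^3"
  where "line_projection v = (\<chi> i j. v $ i * cnj (v $ j) / of_real ((norm v)\<^sup>2))"

lemma norm_vector_smult: "norm (c *s (v :: complex^3)) = norm c * norm v"
  by (simp add: norm_vec_def norm_mult L2_set_right_distrib)

lemma line_projection_smult:
  assumes "c \<noteq> 0"
  shows "line_projection (c *s v) = line_projection v"
proof -
  have "c * a * cnj (c * b) / of_real ((norm c * norm v)\<^sup>2) = a * cnj b / of_real ((norm v)\<^sup>2)" for a b
  proof -
    have "c * a * cnj (c * b) / of_real ((norm c * norm v)\<^sup>2)
        = (c * cnj c) * (a * cnj b) / (of_real ((norm c)\<^sup>2) * of_real ((norm v)\<^sup>2))"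
      by (simp add: power_mult_distrib mult_ac)
    also have "c * cnj c = of_real ((norm c)\<^sup>2)"
      by (rule complex_norm_square[symmetric])
    finally show ?thesis using assms by simp
  qed
  then show ?thesis by (simp add: line_projection_def vec_eq_iff norm_vector_smult)
qed

lemma line_projection_mult_vec:
  "line_projection w *v v = ((\<Sum>j\<in>UNIV. cnj (w $ j) * v $ j) / of_real ((norm w)\<^sup>2)) *s w"
  by (simp add: vec_eq_iff line_projection_def matrix_vector_mult_def sum_distrib_left
      sum_divide_distrib mult_ac)

lemma line_projection_self:
  assumes "v \<noteq> 0"
  shows "line_projection v *v v = v"
proof -
  have "(\<Sum>j\<in>UNIV. cnj (v $ j) * v $ j) = of_real (\<Sum>j\<in>UNIV. (norm (v $ j))\<^sup>2)"
    unfolding of_real_sum by (intro sum.cong refl) (simp only: complex_norm_square mult.commute)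
  also have "(\<Sum>j\<in>UNIV. (norm (v $ j))\<^sup>2) = (norm v)\<^sup>2"
    by (simp add: norm_vec_def L2_set_def sum_nonneg)
  finally show ?thesis using assms by (simp add: line_projection_mult_vec)
qed

lemma line_projection_eq_iff:
  assumes "v \<noteq> 0" "w \<noteq> 0"
  shows "line_projection v = line_projection w \<longleftrightarrow> pt v = pt w"
proof
  assume "line_projection v = line_projection w"
  with line_projection_self[OF assms(1)] obtain c where c: "v = c *s w"
    by (metis line_projection_mult_vec)
  with assms have "c \<noteq> 0" by auto
  with c assms show "pt v = pt w" by (metis pt_eq_iff)
next
  assume "pt v = pt w"
  with assms show "line_projection v = line_projection w"
    by (metis pt_eq_iff line_projection_smult)
qed

instantiation cp2 :: metric_space
begin

definition dist_cp2 :: "cp2 \<Rightarrow> cp2 \<Rightarrow> real"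
  where "dist_cp2 x y = dist (line_projection (rep_cp2 x)) (line_projection (rep_cp2 y))"

definition uniformity_cp2 :: "(cp2 \<times> cp2) filter"
  where "uniformity_cp2 = (INF e\<in>{0<..}. principal {(x, y). dist x y < e})"

definition open_cp2 :: "cp2 set \<Rightarrow> bool"
  where "open_cp2 U \<longleftrightarrow> (\<forall>x\<in>U. eventually (\<lambda>(x', y). x' = x \<longrightarrow> y \<in> U) uniformity)"

instance
proof
  fix x y z :: cp2
  show "dist x y = 0 \<longleftrightarrow> x = y"
    using line_projection_eq_iff[of "rep_cp2 x" "rep_cp2 y"] by (simp add: dist_cp2_def)
  show "dist x y \<le> dist x z + dist y z"
    unfolding dist_cp2_def by (rule dist_triangle2)
qed (simp_all only: uniformity_cp2_def open_cp2_def)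

end

lemma dist_pt:
  assumes "v \<noteq> 0" "w \<noteq> 0"
  shows "dist (pt v) (pt w) = dist (line_projection v) (line_projection w)"
proof -
  have "line_projection (rep_cp2 (pt u)) = line_projection u" if "u \<noteq> 0" for u
    using that by (metis rep_cp2_pt line_projection_smult)
  with assms show ?thesis by (simp add: dist_cp2_def)
qed

lemma continuous_on_line_projection: "continuous_on (- {0}) line_projection"
  unfolding line_projection_def
  by (intro continuous_intros) auto

lemma continuous_on_pt: "continuous_on (- {0}) pt"
  using continuous_on_line_projection
  by (auto simp: continuous_on_iff dist_pt)

lemma open_cp2_iff: "open U \<longleftrightarrow> open {v. v \<noteq> 0 \<and> pt v \<in> U}"
proof
  assume "open U"
  then have "open (- {0} \<inter> pt -` U)"
    using continuous_open_preimage[OF continuous_on_pt] by (simp add: open_Compl)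
  also have "- {0} \<inter> pt -` U = {v. v \<noteq> 0 \<and> pt v \<in> U}" by auto
  finally show "open {v. v \<noteq> 0 \<and> pt v \<in> U}" .
next
  assume *: "open {v. v \<noteq> 0 \<and> pt v \<in> U}"
  show "open U"
    unfolding open_dist
  proof
    fix x assume "x \<in> U"
    obtain v where v: "v \<noteq> 0" "x = pt v" by (rule cp2_cases)
    with * \<open>x \<in> U\<close> obtain e where e: "e > 0" "\<And>w. dist w v < e \<Longrightarrow> w \<noteq> 0 \<and> pt w \<in> U"
      unfolding open_dist by blast
    have "linear (\<lambda>A::complex^3^3. A *v v)"
    proof (rule linearI)
      show "(A + B) *v v = A *v v + B *v v" for A B :: "complex^3^3"
        by (rule matrix_vector_mult_add_rdistrib)
      show "(r *\<^sub>R A) *v v = r *\<^sub>R (A *v v)" for r and A :: "complex^3^3"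
        by (simp add: vec_eq_iff matrix_vector_mult_def scaleR_sum_right)
    qed
    from linear_bounded_pos[OF this]
    obtain B where B: "B > 0" "\<And>A :: complex^3^3. norm (A *v v) \<le> B * norm A"
      by blast
    show "\<exists>d>0. \<forall>y. dist y x < d \<longrightarrow> y \<in> U"
    proof (intro exI conjI allI impI)
      show "e / B > 0" using e B by simp
      fix y assume y: "dist y x < e / B"
      obtain w where w: "w \<noteq> 0" "y = pt w" by (rule cp2_cases)
      let ?u = "line_projection w *v v"
      have "dist ?u v = norm ((line_projection w - line_projection v) *v v)"
        by (simp add: dist_norm matrix_vector_mult_diff_rdistrib line_projection_self v)
      also have "\<dots> \<le> B * dist y x"
        using B(2) by (simp add: dist_pt v w dist_norm)
      also have "\<dots> < e" using y B(1) by (simp add: field_simps)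
      finally have u: "?u \<noteq> 0" "pt ?u \<in> U" using e(2) by auto
      obtain c where c: "?u = c *s w" by (metis line_projection_mult_vec)
      with u(1) have "c \<noteq> 0" by auto
      with c u(1) w have "pt ?u = y" by (metis pt_eq_iff)
      with u(2) show "y \<in> U" by simp
    qed
  qed
qed

definition projectivization :: "(complex^3) set \<Rightarrow> cp2 set"
  where "projectivization W = {pt v | v. v \<in> W \<and> v \<noteq> 0}"

definition projective_line :: "cp2 set \<Rightarrow> bool"
  where "projective_line l \<longleftrightarrow> (\<exists>W. vec.subspace W \<and> vec.dim W = 2 \<and> l = projectivization W)"

definition full_flag :: "cp2 \<Rightarrow> cp2 set \<Rightarrow> bool"
  where "full_flag p l \<longleftrightarrow> projective_line l \<and> p \<in> l"


section \<open>Pseudo-projective maps\<close>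

definition mat_proportional :: "complex^3^3 \<Rightarrow> complex^3^3 \<Rightarrow> bool"
  where "mat_proportional A B \<longleftrightarrow> A \<noteq> 0 \<and> B \<noteq> 0 \<and> (\<exists>c. c \<noteq> 0 \<and> B = mat c ** A)"

lemma mat_mult_nth [simp]: "(mat c ** (A :: complex^'n^'m)) $ i $ j = c * A $ i $ j"
  by (simp add: matrix_matrix_mult_def mat_def if_distrib if_distribR cong: if_cong)

lemma mult_mat_nth [simp]: "((A :: complex^'n^'m) ** mat c) $ i $ j = A $ i $ j * c"
  by (simp add: matrix_matrix_mult_def mat_def if_distrib if_distribR cong: if_cong)

lemma mat_mult_mat [simp]: "mat c ** mat d = (mat (c * d) :: complex^'n^'n)"
  by (simp add: vec_eq_iff) (simp add: mat_def)

lemma mat_mult_vec [simp]: "mat c *v (v :: complex^'n) = c *s v"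
  by (simp add: vec_eq_iff matrix_vector_mult_def mat_def if_distrib if_distribR cong: if_cong)

lemma mat_proportional_part_equivp: "part_equivp mat_proportional"
proof (rule part_equivpI)
  show "\<exists>A. mat_proportional A A"
  proof
    have "mat 1 \<noteq> (0 :: complex^3^3)" by (simp add: vec_eq_iff) (simp add: mat_def)
    then show "mat_proportional (mat 1) (mat 1)"
      by (auto simp: mat_proportional_def intro!: exI[of _ 1])
  qed
  show "symp mat_proportional"
  proof (rule sympI)
    fix A B assume "mat_proportional A B"
    then obtain c where c: "A \<noteq> 0" "B \<noteq> 0" "c \<noteq> 0" "B = mat c ** A"
      by (auto simp: mat_proportional_def)
    then have "A = mat (inverse c) ** B" by (simp add: matrix_mul_assoc)
    with c show "mat_proportional B A"
      unfolding mat_proportional_def by (metis inverse_nonzero_iff_nonzero)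
  qed
  show "transp mat_proportional"
  proof (rule transpI)
    fix A B C assume "mat_proportional A B" "mat_proportional B C"
    then show "mat_proportional A C"
      unfolding mat_proportional_def by (metis mult_eq_0_iff matrix_mul_assoc mat_mult_mat)
  qed
qed

quotient_type sp3 = "complex^3^3" / partial: mat_proportional
  morphisms rep_sp3 sp
  by (rule mat_proportional_part_equivp)

lemma sp_eq_iff:
  assumes "A \<noteq> 0" "B \<noteq> 0"
  shows "sp A = sp B \<longleftrightarrow> (\<exists>c. c \<noteq> 0 \<and> B = mat c ** A)"
proof -
  have "mat_proportional A A" "mat_proportional B B"
    using assms by (auto simp: mat_proportional_def intro!: exI[of _ 1])
  then have "sp A = sp B \<longleftrightarrow> mat_proportional A B"
    using Quotient3_rel[OF Quotient3_sp3, of A B] by auto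
  with assms show ?thesis by (simp add: mat_proportional_def)
qed

lemma rep_sp3_nonzero [simp]: "rep_sp3 S \<noteq> 0"
  using Quotient3_rep_reflp[OF Quotient3_sp3, of S] by (simp add: mat_proportional_def)

lemma sp_rep_sp3 [simp]: "sp (rep_sp3 S) = S"
  by (rule Quotient3_abs_rep[OF Quotient3_sp3])

lemma rep_sp3_sp:
  assumes "A \<noteq> 0"
  obtains c where "c \<noteq> 0" "rep_sp3 (sp A) = mat c ** A"
  using assms sp_eq_iff[of A "rep_sp3 (sp A)"] by auto

definition sp_ker :: "sp3 \<Rightarrow> cp2 set"
  where "sp_ker S = projectivization {v. rep_sp3 S *v v = 0}"

text \<open>On \<open>sp_ker S\<close> the value of \<open>sp_map S\<close> is the meaningless \<open>pt 0\<close>.\<close>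

definition sp_map :: "sp3 \<Rightarrow> cp2 \<Rightarrow> cp2"
  where "sp_map S x = pt (rep_sp3 S *v rep_cp2 x)"

definition sp_im :: "sp3 \<Rightarrow> cp2 set"
  where "sp_im S = sp_map S ` (- sp_ker S)"

lemma sp_ker_sp:
  assumes "A \<noteq> 0"
  shows "sp_ker (sp A) = projectivization {v. A *v v = 0}"
proof -
  obtain c where "c \<noteq> 0" "rep_sp3 (sp A) = mat c ** A"
    using assms by (rule rep_sp3_sp)
  then have "rep_sp3 (sp A) *v v = 0 \<longleftrightarrow> A *v v = 0" for v
    by (simp add: matrix_vector_mul_assoc[symmetric])
  then show ?thesis by (simp add: sp_ker_def)
qed

lemma sp_map_sp:
  assumes "A *v v \<noteq> 0"
  shows "sp_map (sp A) (pt v) = pt (A *v v)"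
proof -
  from assms have "A \<noteq> 0" "v \<noteq> 0" by auto
  obtain c where c: "c \<noteq> 0" "rep_sp3 (sp A) = mat c ** A"
    using \<open>A \<noteq> 0\<close> by (rule rep_sp3_sp)
  obtain d where d: "d \<noteq> 0" "rep_cp2 (pt v) = d *s v"
    using \<open>v \<noteq> 0\<close> by (rule rep_cp2_pt)
  have "rep_sp3 (sp A) *v rep_cp2 (pt v) = (c * d) *s (A *v v)"
    by (simp add: c d matrix_vector_mul_assoc[symmetric] vector_scalar_commute vector_smult_assoc)
  moreover have "pt (A *v v) = pt ((c * d) *s (A *v v))"
    using assms c d by (subst pt_eq_iff) auto
  ultimately show ?thesis by (simp add: sp_map_def)
qed


section \<open>The group PSL(3,C)\<close>

definition SL3 :: "(complex^3^3) monoid"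
  where "SL3 = \<lparr>carrier = {A. det A = 1}, mult = (**), one = mat 1\<rparr>"

definition SL3_center :: "(complex^3^3) set"
  where "SL3_center = {mat c | c. c ^ 3 = 1}"

definition PSL3 :: "(complex^3^3) set monoid"
  where "PSL3 = SL3 Mod SL3_center"

lemma SL3_simps [simp]:
  "A \<in> carrier SL3 \<longleftrightarrow> det A = 1" "A \<otimes>\<^bsub>SL3\<^esub> B = A ** B" "\<one>\<^bsub>SL3\<^esub> = mat 1"
  by (simp_all add: SL3_def)

lemma group_SL3: "group SL3"
proof (rule groupI)
  fix A assume "A \<in> carrier SL3"
  then have "det A = 1" by simp
  then have "invertible A" by (simp add: invertible_det_nz)
  then obtain B where B: "A ** B = mat 1" "B ** A = mat 1"
    by (auto simp: invertible_def)
  from B(2) have "det B * det A = 1" by (metis det_mul det_I)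
  with \<open>det A = 1\<close> B(2) show "\<exists>B\<in>carrier SL3. B \<otimes>\<^bsub>SL3\<^esub> A = \<one>\<^bsub>SL3\<^esub>"
    by (intro bexI[of _ B]) auto
qed (auto simp: det_mul det_I matrix_mul_assoc)

lemma det_mat3: "det (mat c :: complex^3^3) = c ^ 3"
  by (simp add: det_3 mat_def power3_eq_cube)

lemma SL3_center_eq: "SL3_center = {A \<in> carrier SL3. \<forall>B\<in>carrier SL3. A ** B = B ** A}"
proof
  show "SL3_center \<subseteq> {A \<in> carrier SL3. \<forall>B\<in>carrier SL3. A ** B = B ** A}"
  proof
    fix A assume "A \<in> SL3_center"
    then obtain c where c: "A = mat c" "c ^ 3 = 1" by (auto simp: SL3_center_def)
    moreover have "mat c ** B = B ** mat c" for B :: "complex^3^3"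
      by (simp add: vec_eq_iff mult.commute)
    ultimately show "A \<in> {A \<in> carrier SL3. \<forall>B\<in>carrier SL3. A ** B = B ** A}"
      by (simp add: det_mat3)
  qed
  show "{A \<in> carrier SL3. \<forall>B\<in>carrier SL3. A ** B = B ** A} \<subseteq> SL3_center"
  proof clarify
    fix A assume A: "A \<in> carrier SL3" and comm: "\<forall>B\<in>carrier SL3. A ** B = B ** A"
    define E :: "3 \<Rightarrow> 3 \<Rightarrow> complex^3^3"
      where "E a b = (\<chi> i j. (if i = j then 1 else 0) + (if i = a \<and> j = b then 1 else 0))" for a b
    have E: "A ** E a b = E a b ** A" if "a \<noteq> b" for a b
    proof -
      have "det (E a b) = 1"
        using that exhaust_3[of a] exhaust_3[of b] by (auto simp: E_def det_3)
      with comm show ?thesis by simp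
    qed
    have *: "(A ** E a b) $ i $ j = (E a b ** A) $ i $ j" if "a \<noteq> b" for a b i j
      using E[OF that] by simp
    note ** = *[unfolded E_def matrix_matrix_mult_def, simplified sum_3 vec_lambda_beta]
    have "A $ 1 $ 1 = A $ 2 $ 2" "A $ 1 $ 1 = A $ 3 $ 3"
      using **[of 1 2 1 2] **[of 1 3 1 3] by (simp_all add: algebra_simps)
    moreover have "A $ 1 $ 2 = 0" "A $ 1 $ 3 = 0" "A $ 2 $ 1 = 0" "A $ 2 $ 3 = 0" "A $ 3 $ 1 = 0" "A $ 3 $ 2 = 0"
      using **[of 2 1 1 1] **[of 3 1 1 1] **[of 1 2 2 2] **[of 3 2 2 2] **[of 1 3 3 3] **[of 2 3 3 3]
      by (simp_all add: algebra_simps)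
    ultimately have "A = mat (A $ 1 $ 1)"
      by (simp add: vec_eq_iff mat_def forall_3)
    then obtain c where c: "A = mat c" by blast
    with A have "c ^ 3 = 1" by (simp add: det_mat3)
    with c show "A \<in> SL3_center"
      unfolding SL3_center_def by blast
  qed
qed

lemma normal_SL3_center: "SL3_center \<lhd> SL3"
proof -
  interpret group SL3 by (rule group_SL3)
  have sub: "subgroup SL3_center SL3"
  proof (rule subgroupI)
    show "SL3_center \<subseteq> carrier SL3" by (auto simp: SL3_center_eq)
    show "SL3_center \<noteq> {}" by (auto simp: SL3_center_def intro!: exI[of _ 1])
  next
    fix A assume "A \<in> SL3_center"
    then obtain c where c: "A = mat c" "c ^ 3 = 1" by (auto simp: SL3_center_def)
    then have "c \<noteq> 0" by auto
    with c have "mat (inverse c) \<otimes>\<^bsub>SL3\<^esub> A = \<one>\<^bsub>SL3\<^esub>" by simp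
    then have "inv\<^bsub>SL3\<^esub> A = mat (inverse c)"
      using c by (intro inv_equality) (simp_all add: det_mat3 power_inverse)
    with c show "inv\<^bsub>SL3\<^esub> A \<in> SL3_center" by (auto simp: SL3_center_def power_inverse)
  next
    fix A B assume "A \<in> SL3_center" "B \<in> SL3_center"
    then show "A \<otimes>\<^bsub>SL3\<^esub> B \<in> SL3_center"
      by (auto simp: SL3_center_def power_mult_distrib)
  qed
  show ?thesis
  proof (rule normalI[OF sub], rule ballI)
    fix A assume "A \<in> carrier SL3"
    then show "SL3_center #>\<^bsub>SL3\<^esub> A = A <#\<^bsub>SL3\<^esub> SL3_center"
      unfolding r_coset_def l_coset_def by (intro SUP_cong refl) (simp add: SL3_center_eq)
  qed
qed

lemma group_PSL3: "group PSL3"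
  unfolding PSL3_def by (rule normal.factorgroup_is_group[OF normal_SL3_center])

text \<open>The quotient topology of the matrix topology on SL(3,C).\<close>

definition PSL3_topology :: "(complex^3^3) set topology"
  where "PSL3_topology =
    topology (\<lambda>U. U \<subseteq> carrier PSL3 \<and> openin (top_of_set (carrier SL3)) (\<Union>U))"

lemma coset_SL3_center: "SL3_center #>\<^bsub>SL3\<^esub> A = {mat c ** A | c. c ^ 3 = 1}"
  by (auto simp: r_coset_def SL3_center_def)

lemma carrier_PSL3: "carrier PSL3 = (\<lambda>A. SL3_center #>\<^bsub>SL3\<^esub> A) ` carrier SL3"
  by (simp add: PSL3_def carrier_FactGroup)

lemma Union_PSL3:
  assumes "U \<subseteq> carrier PSL3"
  shows "\<Union>U = {A \<in> carrier SL3. SL3_center #>\<^bsub>SL3\<^esub> A \<in> U}"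
proof -
  interpret normal SL3_center SL3 by (rule normal_SL3_center)
  have "A \<in> carrier SL3 \<and> SL3_center #>\<^bsub>SL3\<^esub> A = X" if "X \<in> carrier PSL3" "A \<in> X" for A X
  proof -
    from that(1) obtain B where B: "B \<in> carrier SL3" "X = SL3_center #>\<^bsub>SL3\<^esub> B"
      unfolding carrier_PSL3 by blast
    with that(2) have "SL3_center #>\<^bsub>SL3\<^esub> B = SL3_center #>\<^bsub>SL3\<^esub> A"
      by (intro repr_independence subgroup_axioms) auto
    moreover have "A \<in> carrier SL3"
      using r_coset_subset_G[OF subset B(1)] that(2) B(2) by blast
    ultimately show ?thesis using B by simp
  qed
  moreover have "A \<in> SL3_center #>\<^bsub>SL3\<^esub> A" if "A \<in> carrier SL3" for A
    using that by (rule rcos_self[OF _ subgroup_axioms])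
  ultimately show ?thesis using assms by blast
qed

lemma openin_PSL3_topology:
  "openin PSL3_topology U \<longleftrightarrow> U \<subseteq> carrier PSL3 \<and> openin (top_of_set (carrier SL3)) (\<Union>U)"
proof -
  have "istopology (\<lambda>U. U \<subseteq> carrier PSL3 \<and> openin (top_of_set (carrier SL3)) (\<Union>U))"
    unfolding istopology_def
  proof (intro conjI allI impI; (elim conjE)?)
    fix U V
    assume U: "U \<subseteq> carrier PSL3" "openin (top_of_set (carrier SL3)) (\<Union>U)"
      and V: "V \<subseteq> carrier PSL3" "openin (top_of_set (carrier SL3)) (\<Union>V)"
    then show "U \<inter> V \<subseteq> carrier PSL3" by blast
    then have "\<Union>(U \<inter> V) = \<Union>U \<inter> \<Union>V"
      using U(1) V(1) by (auto simp: Union_PSL3)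
    with U V show "openin (top_of_set (carrier SL3)) (\<Union>(U \<inter> V))"
      by (simp add: openin_Int)
  next
    fix K assume K: "\<forall>U\<in>K. U \<subseteq> carrier PSL3 \<and> openin (top_of_set (carrier SL3)) (\<Union>U)"
    then show "\<Union>K \<subseteq> carrier PSL3" by blast
    have "openin (top_of_set (carrier SL3)) (\<Union>(Union ` K))"
      by (rule openin_Union) (use K in blast)
    also have "\<Union>(Union ` K) = \<Union>(\<Union>K)" by blast
    finally show "openin (top_of_set (carrier SL3)) (\<Union>(\<Union>K))" .
  qed
  then show ?thesis by (simp add: PSL3_topology_def topology_inverse')
qed

lemma topspace_PSL3: "topspace PSL3_topology = carrier PSL3"
proof
  show "topspace PSL3_topology \<subseteq> carrier PSL3"
    using openin_topspace[of PSL3_topology] unfolding openin_PSL3_topology by (rule conjunct1)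
  have "\<Union>(carrier PSL3) = carrier SL3"
    unfolding Union_PSL3[OF order_refl] by (auto simp: carrier_PSL3)
  then have "openin PSL3_topology (carrier PSL3)"
    by (simp add: openin_PSL3_topology del: SL3_simps)
  then show "carrier PSL3 \<subseteq> topspace PSL3_topology" by (rule openin_subset)
qed

lemma quotient_map_PSL3:
  "quotient_map (top_of_set (carrier SL3)) PSL3_topology (\<lambda>A. SL3_center #>\<^bsub>SL3\<^esub> A)"
  by (auto simp: quotient_map_def topspace_PSL3 carrier_PSL3[symmetric] openin_PSL3_topology
      Union_PSL3 simp del: SL3_simps)

definition discrete_subgroup_PSL3 :: "(complex^3^3) set set \<Rightarrow> bool"
  where "discrete_subgroup_PSL3 G \<longleftrightarrow>
    subgroup G PSL3 \<and> subtopology PSL3_topology G = discrete_topology G"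

text \<open>An element of \<open>PSL3\<close> is a coset of matrices that differ by scalars, so it does not matter
  which of them is used to act.\<close>

definition act :: "(complex^3^3) set \<Rightarrow> cp2 \<Rightarrow> cp2"
  where "act g = sp_map (sp (SOME A. A \<in> g))"

lemma act_coset:
  assumes "det A = 1" "v \<noteq> 0"
  shows "act (SL3_center #>\<^bsub>SL3\<^esub> A) (pt v) = pt (A *v v)"
proof -
  let ?g = "SL3_center #>\<^bsub>SL3\<^esub> A"
  have "\<exists>B. B \<in> ?g" unfolding coset_SL3_center by (auto intro!: exI[of _ 1])
  then have "(SOME B. B \<in> ?g) \<in> ?g" by (rule someI_ex)
  then obtain c where c: "(SOME B. B \<in> ?g) = mat c ** A" "c ^ 3 = 1"
    unfolding coset_SL3_center by blast
  then have "c \<noteq> 0" by auto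
  have "invertible A" using assms by (simp add: invertible_det_nz)
  then obtain B where B: "B ** A = mat 1" by (auto simp: invertible_def)
  have Av: "A *v v \<noteq> 0"
  proof
    assume "A *v v = 0"
    then have "(B ** A) *v v = 0" by (simp add: matrix_vector_mul_assoc[symmetric])
    with B assms(2) show False by simp
  qed
  have "mat c ** A *v v = c *s (A *v v)"
    by (simp add: matrix_vector_mul_assoc[symmetric])
  moreover from this Av \<open>c \<noteq> 0\<close> have "sp_map (sp (mat c ** A)) (pt v) = pt (mat c ** A *v v)"
    by (intro sp_map_sp) simp
  moreover have "pt (A *v v) = pt (c *s (A *v v))"
    using Av \<open>c \<noteq> 0\<close> by (subst pt_eq_iff) auto
  ultimately show ?thesis by (simp add: act_def c)
qed


section \<open>Limits\<close>

definition locally_uniform_limit ::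
    "'a::topological_space set \<Rightarrow> (nat \<Rightarrow> 'a \<Rightarrow> 'b::metric_space) \<Rightarrow> ('a \<Rightarrow> 'b) \<Rightarrow> bool"
  where "locally_uniform_limit U f h \<longleftrightarrow>
    (\<forall>x\<in>U. \<exists>V. openin (top_of_set U) V \<and> x \<in> V \<and> uniform_limit V f h sequentially)"

definition destinations :: "(nat \<Rightarrow> (complex^3^3) set) \<Rightarrow> cp2 \<Rightarrow> cp2 set"
  where "destinations g x = {y. \<exists>X m. X \<longlonglongrightarrow> x \<and> filterlim m at_top sequentially \<and>
    (\<lambda>j. act (g (m j)) (X (m j))) \<longlonglongrightarrow> y}"

definition full_flag_case :: "(nat \<Rightarrow> (complex^3^3) set) \<Rightarrow> bool"
  where "full_flag_case g \<longleftrightarrow> (\<exists>p_plus l_plus p_minus l_minus.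
    full_flag p_plus l_plus \<and> full_flag p_minus l_minus \<and>
    locally_uniform_limit (- l_plus) (\<lambda>n. act (g n)) (\<lambda>_. p_minus) \<and>
    locally_uniform_limit (- l_minus) (\<lambda>n. act (inv\<^bsub>PSL3\<^esub> (g n))) (\<lambda>_. p_plus) \<and>
    (\<forall>x \<in> l_plus - {p_plus}. destinations g x = l_minus))"

definition point_to_line_case :: "(nat \<Rightarrow> (complex^3^3) set) \<Rightarrow> bool"
  where "point_to_line_case g \<longleftrightarrow> (\<exists>p_plus l_minus S.
    projective_line l_minus \<and> sp_ker S = {p_plus} \<and> sp_im S = l_minus \<and>
    locally_uniform_limit (- {p_plus}) (\<lambda>n. act (g n)) (sp_map S) \<and>
    locally_uniform_limit (- l_minus) (\<lambda>n. act (inv\<^bsub>PSL3\<^esub> (g n))) (\<lambda>_. p_plus))"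

definition line_to_point_case :: "(nat \<Rightarrow> (complex^3^3) set) \<Rightarrow> bool"
  where "line_to_point_case g \<longleftrightarrow> (\<exists>l_plus p_minus S.
    projective_line l_plus \<and> sp_ker S = {p_minus} \<and> sp_im S = l_plus \<and>
    locally_uniform_limit (- l_plus) (\<lambda>n. act (g n)) (\<lambda>_. p_minus) \<and>
    locally_uniform_limit (- {p_minus}) (\<lambda>n. act (inv\<^bsub>PSL3\<^esub> (g n))) (sp_map S))"

end

theory Submission
  imports Defs
begin

text \<open>
  Discreteness forces the matrices \<open>A\<^sub>n\<close> representing \<open>g\<^sub>n\<close> and their inverses \<open>B\<^sub>n\<close> to leave every
  bounded set. After passing to a subsequence the normalized matrices \<open>A\<^sub>n / |A\<^sub>n|\<close> and
  \<open>B\<^sub>n / |B\<^sub>n|\<close> converge to nonzero matrices \<open>P\<close> and \<open>Q\<close> with \<open>P Q = Q P = 0\<close>. Off the kernels of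
  \<open>P\<close> and \<open>Q\<close> the maps converge locally uniformly to the pseudo-projective maps of \<open>P\<close> and \<open>Q\<close>.
  Since \<open>rank P + rank Q \<le> 3\<close>, the possible ranks are \<open>(1, 1)\<close>, \<open>(2, 1)\<close> and \<open>(1, 2)\<close>, which are the
  three cases; in the last two the kernel of each matrix is the image of the other.
\<close>

section \<open>Linear algebra\<close>

text \<open>A basis \<open>B\<close> of the kernel is extended to a basis \<open>C\<close> of the
  whole space. On the span of \<open>C - B\<close> the map is injective, and it already reaches the
  full range there, so the rank is \<open>card C - card B\<close>.\<close>

lemma vec_rank_nullity:
  fixes A :: "'a::field^'n^'m"
  shows "vec.dim {v. A *v v = 0} + vec.dim (range ((*v) A)) = CARD('n)"
proof -
  let ?K = "{v. A *v v = 0}"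
  have K: "vec.subspace ?K"
    by (auto simp: vec.subspace_def matrix_vector_right_distrib vector_scalar_commute)
  obtain B where B: "B \<subseteq> ?K" "vec.independent B" "vec.span B = ?K" "card B = vec.dim ?K"
    by (rule vec.basis_subspace_exists[OF K])
  obtain C where C: "B \<subseteq> C" "vec.independent C" "UNIV \<subseteq> vec.span C"
    by (rule vec.maximal_independent_subset_extend[OF subset_UNIV B(2)])
  then have spanC: "vec.span C = UNIV" by blast
  have fin: "finite C" using C(2) by (rule vec.finiteI_independent)
  have card: "card C = CARD('n)"
    using vec.dim_span_eq_card_independent[OF C(2)] spanC vec_dim_card[where 'a='a and 'n='n]
    by (simp del: vec.dim_UNIV)
  have indD: "vec.independent (C - B)" using C(2) vec.independent_mono by blast
  have inj: "inj_on ((*v) A) (vec.span (C - B))"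
  proof (rule inj_onI)
    fix x y assume xy: "x \<in> vec.span (C - B)" "y \<in> vec.span (C - B)" "A *v x = A *v y"
    have d: "x - y \<in> vec.span (C - B)" using xy vec.span_diff by blast
    have "x - y \<in> vec.span B" using xy(3) B(3) by (simp add: matrix_vector_mult_diff_distrib)
    \<comment> \<open>The vector \<open>x - y\<close> lies in the spans of both \<open>B\<close> and
      \<open>C - B\<close>, so its coordinates over \<open>C\<close> are supported in two disjoint
      sets.\<close>
    have r: "vec.representation C (x - y) b = 0" for b
    proof (cases "b \<in> B")
      case True
      have "vec.representation C (x - y) = vec.representation (C - B) (x - y)"
        using C(2) d by (rule vec.representation_extend) auto
      then show ?thesis using True vec.representation_ne_zero[of "C - B" "x - y" b] by auto
    next
      case False
      have "vec.representation C (x - y) = vec.representation B (x - y)"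
        using C(2) \<open>x - y \<in> vec.span B\<close> C(1) by (rule vec.representation_extend)
      then show ?thesis using False vec.representation_ne_zero[of B "x - y" b] by auto
    qed
    have "x - y = (\<Sum>b | vec.representation C (x - y) b \<noteq> 0. vec.representation C (x - y) b *s b)"
      using vec.sum_nonzero_representation_eq[OF C(2), of "x - y"] spanC by simp
    also have "\<dots> = 0" using r by simp
    finally show "x = y" by simp
  qed
  have "range ((*v) A) = (*v) A ` vec.span (C - B)"
  proof
    show "range ((*v) A) \<subseteq> (*v) A ` vec.span (C - B)"
    proof clarify
      fix v
      have "v \<in> vec.span (B \<union> (C - B))" using C(1) spanC by (simp add: Un_absorb1)
      then obtain a b where "v = a + b" "a \<in> vec.span B" "b \<in> vec.span (C - B)"
        unfolding vec.span_Un by blast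
      then show "A *v v \<in> (*v) A ` vec.span (C - B)"
        using B(3) by (auto simp: matrix_vector_right_distrib)
    qed
  qed auto
  then have "vec.dim (range ((*v) A)) = vec.dim (vec.span (C - B))"
    using vec.dim_image_eq[OF matrix_vector_mul_linear_gen, of A "vec.span (C - B)"] inj
    by (simp add: vec.span_span)
  also have "\<dots> = card C - card B"
    by (simp add: vec.dim_span_eq_card_independent[OF indD, unfolded vec.dim_span]
        card_Diff_subset[OF finite_subset[OF C(1) fin] C(1)])
  finally show ?thesis
    using B(4) card card_mono[OF fin C(1)] by simp
qed

section \<open>Continuity of the matrix operations\<close>

lemma tendsto_matrix_vector_mult [tendsto_intros]:
  fixes M :: "'b \<Rightarrow> complex^'n^'m"
  assumes "(M \<longlongrightarrow> A) F" "(v \<longlongrightarrow> w) F"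
  shows "((\<lambda>k. M k *v v k) \<longlongrightarrow> A *v w) F"
  unfolding matrix_vector_mult_def using assms by (intro tendsto_intros)

lemma tendsto_matrix_matrix_mult [tendsto_intros]:
  fixes M :: "'b \<Rightarrow> complex^'n^'m" and N :: "'b \<Rightarrow> complex^'k^'n"
  assumes "(M \<longlongrightarrow> A) F" "(N \<longlongrightarrow> B) F"
  shows "((\<lambda>k. M k ** N k) \<longlongrightarrow> A ** B) F"
  unfolding matrix_matrix_mult_def using assms by (intro tendsto_intros)

lemma tendsto_vector_smult [tendsto_intros]:
  fixes v :: "'b \<Rightarrow> complex^'n"
  assumes "(c \<longlongrightarrow> l) F" "(v \<longlongrightarrow> w) F"
  shows "((\<lambda>k. c k *s v k) \<longlongrightarrow> l *s w) F"
  unfolding vector_scalar_mult_def using assms by (intro tendsto_intros)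

lemma tendsto_det [tendsto_intros]:
  fixes M :: "'b \<Rightarrow> complex^'n^'n"
  assumes "(M \<longlongrightarrow> A) F"
  shows "((\<lambda>k. det (M k)) \<longlongrightarrow> det A) F"
  unfolding det_def using assms by (intro tendsto_intros)

text \<open>Cramer's rule writes the entries of the inverse as quotients of determinants, which are
  continuous where the determinant does not vanish.\<close>

lemma tendsto_matrix_right_inverse:
  fixes M N :: "'b \<Rightarrow> complex^'n^'n"
  assumes lim: "(M \<longlongrightarrow> A) F" and det: "\<And>k. det (M k) = 1" and inv: "\<And>k. M k ** N k = mat 1"
    and AB: "A ** B = mat 1"
  shows "(N \<longlongrightarrow> B) F"
proof -
  define I :: "complex^'n^'n \<Rightarrow> complex^'n^'n"
    where "I X = (\<chi> i j. det (\<chi> k l. if l = i then (mat 1 :: complex^'n^'n) $ k $ j else X $ k $ l) / det X)" for X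
  have I: "Y = I X" if "det X \<noteq> 0" "X ** Y = mat 1" for X Y
  proof -
    have "X *v column j Y = column j (mat 1)" for j
      unfolding that(2)[symmetric] by (simp add: column_def matrix_matrix_mult_def matrix_vector_mult_def)
    then have "column j Y = (\<chi> i. det (\<chi> k l. if l = i then column j (mat 1) $ k else X $ k $ l) / det X)" for j
      using cramer[OF that(1)] by blast
    then show ?thesis by (simp add: vec_eq_iff I_def column_def cong: if_cong)
  qed
  have "A ** B = mat 1 \<Longrightarrow> det A \<noteq> 0" by (metis det_mul det_I mult_zero_left zero_neq_one)
  with AB have dA: "det A \<noteq> 0" by simp
  have ev: "((\<lambda>k. if l = i then c else M k $ p $ l) \<longlongrightarrow> (if l = i then c else A $ p $ l)) F"
    for l i :: 'n and c and p
    using lim by (cases "l = i") (auto intro: tendsto_intros)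
  have "((\<lambda>k. I (M k)) \<longlongrightarrow> I A) F"
    unfolding I_def using lim dA by (intro tendsto_intros ev)
  moreover have "I (M k) = N k" for k using I[of "M k" "N k"] det inv by simp
  moreover have "I A = B" using I[of A B] dA AB by simp
  ultimately show ?thesis by simp
qed

section \<open>The projective plane and its pseudo-projective maps\<close>

lemma pt_smult [simp]:
  assumes "c \<noteq> 0"
  shows "pt (c *s v) = pt v"
proof (cases "v = 0")
  case False
  with assms show ?thesis by (metis pt_eq_iff vector_mul_eq_0)
qed simp

lemma scaleR_eq_smult: "r *\<^sub>R (v :: complex^'n) = of_real r *s v"
  by (simp add: vec_eq_iff) (simp add: scaleR_conv_of_real)

lemma pt_scaleR [simp]: "r \<noteq> 0 \<Longrightarrow> pt (r *\<^sub>R v) = pt v"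
  by (simp add: scaleR_eq_smult)

lemma pt_in_projectivization_iff:
  assumes "vec.subspace W" "v \<noteq> 0"
  shows "pt v \<in> projectivization W \<longleftrightarrow> v \<in> W"
proof
  assume "pt v \<in> projectivization W"
  then obtain w where "pt v = pt w" "w \<in> W" "w \<noteq> 0"
    by (auto simp: projectivization_def)
  with assms show "v \<in> W"
    by (metis pt_eq_iff vec.subspace_scale)
qed (use assms in \<open>auto simp: projectivization_def\<close>)

lemma subspace_ker: "vec.subspace {v. (A :: 'a::field^'n^'m) *v v = 0}"
  by (auto simp: vec.subspace_def matrix_vector_right_distrib vector_scalar_commute)

lemma subspace_range: "vec.subspace (range ((*v) (A :: 'a::field^'n^'m)))"
  using vec.linear_subspace_image[OF matrix_vector_mul_linear_gen vec.subspace_UNIV] .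

lemma projectivization_span_singleton:
  assumes "w \<noteq> 0"
  shows "projectivization (vec.span {w}) = {pt w}"
proof -
  have "w \<in> vec.span {w}" by (simp add: vec.span_base)
  then show ?thesis
    using assms by (fastforce simp: projectivization_def vec.span_singleton)
qed

lemma vec_dim_1E:
  fixes W :: "('a::field^'n) set"
  assumes "vec.subspace W" "vec.dim W = 1"
  obtains w where "w \<noteq> 0" "W = vec.span {w}"
proof -
  obtain B where B: "vec.independent B" "vec.span B = W" "card B = vec.dim W"
    by (rule vec.basis_subspace_exists[OF assms(1)])
  with assms(2) obtain w where "B = {w}" by (auto simp: card_1_singleton_iff)
  with B that show thesis by (auto simp: vec.dependent_single)
qed

lemma projectivization_dim_1:
  assumes "vec.subspace W" "vec.dim W = 1"
  shows "\<exists>p. projectivization W = {p}"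
  by (rule vec_dim_1E[OF assms]) (auto simp: projectivization_span_singleton)

lemma sp_im_sp:
  assumes "A \<noteq> 0"
  shows "sp_im (sp A) = projectivization (range ((*v) A))"
proof -
  have notin: "pt v \<notin> sp_ker (sp A) \<longleftrightarrow> A *v v \<noteq> 0" if "v \<noteq> 0" for v
    using that pt_in_projectivization_iff[OF subspace_ker, of v A] by (simp add: sp_ker_sp assms)
  show ?thesis
  proof (intro equalityI subsetI)
    fix y assume "y \<in> sp_im (sp A)"
    then obtain x where x: "x \<notin> sp_ker (sp A)" "y = sp_map (sp A) x" by (auto simp: sp_im_def)
    obtain v where v: "v \<noteq> 0" "x = pt v" by (rule cp2_cases)
    with x notin have "A *v v \<noteq> 0" by simp
    with x v show "y \<in> projectivization (range ((*v) A))"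
      by (auto simp: projectivization_def sp_map_sp)
  next
    fix y assume "y \<in> projectivization (range ((*v) A))"
    then obtain v where v: "y = pt (A *v v)" "A *v v \<noteq> 0" by (auto simp: projectivization_def)
    then have "v \<noteq> 0" by auto
    with v notin have "pt v \<in> - sp_ker (sp A)" "y = sp_map (sp A) (pt v)"
      by (simp_all add: sp_map_sp)
    then show "y \<in> sp_im (sp A)" by (auto simp: sp_im_def)
  qed
qed

lemma sp_map_in_projectivization_range:
  assumes "x \<notin> projectivization {v. A *v v = 0}"
  shows "sp_map (sp A) x \<in> projectivization (range ((*v) A))"
proof -
  obtain v where v: "v \<noteq> 0" "x = pt v" by (rule cp2_cases)
  with assms have "A *v v \<noteq> 0" by (simp add: pt_in_projectivization_iff subspace_ker)
  then show ?thesis using v by (auto simp: sp_map_sp projectivization_def)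
qed

text \<open>A single point would confine the plane \<open>W\<close> to the span of one vector. This
  is the final contradiction in the proof of exclusivity.\<close>

lemma projective_line_not_singleton:
  assumes "projective_line l"
  shows "\<not> l \<subseteq> {q}"
proof
  assume l: "l \<subseteq> {q}"
  obtain W where W: "vec.subspace W" "vec.dim W = 2" "l = projectivization W"
    using assms by (auto simp: projective_line_def)
  have "W \<subseteq> vec.span {rep_cp2 q}"
  proof
    fix v assume "v \<in> W"
    show "v \<in> vec.span {rep_cp2 q}"
    proof (cases "v = 0")
      case True
      then show ?thesis by (simp add: vec.span_zero)
    next
      case False
      with \<open>v \<in> W\<close> W l have "pt v = pt (rep_cp2 q)" by (auto simp: projectivization_def)
      with False show ?thesis
        by (metis pt_eq_iff rep_cp2_nonzero vec.span_scale vec.span_base singletonI)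
    qed
  qed
  then have "vec.dim W \<le> card {rep_cp2 q}" by (rule vec.dim_le_card) simp
  with W show False by simp
qed

section \<open>Convergence, compactness and locally uniform limits in the projective plane\<close>

lemma tendsto_pt:
  assumes "(v \<longlongrightarrow> w) F" "w \<noteq> 0"
  shows "((\<lambda>k. pt (v k)) \<longlongrightarrow> pt w) F"
proof -
  have "isCont pt w"
    using continuous_on_pt assms(2) by (simp add: continuous_on_eq_continuous_at open_Compl)
  then show ?thesis using assms(1) by (rule isCont_tendsto_compose)
qed

text \<open>Projecting \<open>v\<close> orthogonally to the line \<open>X k\<close> chooses representatives of \<open>X k\<close> that
  converge to \<open>v\<close>.\<close>

lemma tendsto_cp2_lift:
  fixes X :: "nat \<Rightarrow> cp2"
  assumes "X \<longlonglongrightarrow> pt v" "v \<noteq> 0"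
  obtains u where "\<And>k. u k \<noteq> 0" "\<And>k. X k = pt (u k)" "u \<longlonglongrightarrow> v"
proof -
  define w where "w k = line_projection (rep_cp2 (X k)) *v v" for k
  \<comment> \<open>The projection of \<open>v\<close> vanishes when \<open>X k\<close> is
    orthogonal to \<open>v\<close>. This happens for finitely many \<open>k\<close> only, so the
    default value does not affect the limit.\<close>
  define u where "u k = (if w k = 0 then rep_cp2 (X k) else w k)" for k
  have "(\<lambda>k. dist (X k) (pt v)) \<longlonglongrightarrow> 0"
    using assms(1) by (rule iffD1[OF tendsto_dist_iff])
  moreover have "dist (X k) (pt v) = dist (line_projection (rep_cp2 (X k))) (line_projection v)" for k
    using dist_pt[of "rep_cp2 (X k)" v] assms(2) by simp
  ultimately have "(\<lambda>k. line_projection (rep_cp2 (X k))) \<longlonglongrightarrow> line_projection v"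
    by (subst tendsto_dist_iff) simp
  then have "w \<longlonglongrightarrow> line_projection v *v v"
    unfolding w_def[abs_def] by (rule tendsto_matrix_vector_mult) (rule tendsto_const)
  then have w: "w \<longlonglongrightarrow> v" by (simp add: line_projection_self assms(2))
  then have "\<forall>\<^sub>F k in sequentially. w k \<noteq> 0"
    using assms(2) by (rule tendsto_imp_eventually_ne)
  then have "\<forall>\<^sub>F k in sequentially. w k = u k"
    by eventually_elim (simp add: u_def)
  with w have "u \<longlonglongrightarrow> v" by (rule Lim_transform_eventually)
  moreover have "u k \<noteq> 0" for k by (simp add: u_def)
  moreover have "X k = pt (u k)" for k
  proof (cases "w k = 0")
    case False
    moreover obtain c where c: "w k = c *s rep_cp2 (X k)"
      unfolding w_def by (metis line_projection_mult_vec)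
    ultimately have "c \<noteq> 0" by auto
    with False c show ?thesis by (simp add: u_def)
  qed (simp add: u_def)
  ultimately show thesis using that by blast
qed

lemma compact_cp2: "compact (UNIV :: cp2 set)"
proof -
  have "pt ` sphere 0 1 = UNIV"
  proof (intro equalityI subsetI)
    fix x :: cp2
    obtain v where v: "v \<noteq> 0" "x = pt v" by (rule cp2_cases)
    then have "x = pt (sgn v)" "sgn v \<in> sphere 0 1"
      by (auto simp: sgn_div_norm)
    then show "x \<in> pt ` sphere 0 1" by blast
  qed simp
  moreover have "compact (pt ` sphere 0 1)"
    using continuous_on_pt by (rule compact_continuous_image[OF continuous_on_subset]) auto
  ultimately show ?thesis by simp
qed

text \<open>If uniformity failed on a small ball, there would be indices \<open>m N \<ge> N\<close>
  and points \<open>Y N\<close> of the ball with an error of at least \<open>d\<close>. By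
  compactness a subsequence of these points converges, and there \<open>conv\<close> together with
  continuity of \<open>h\<close> makes the error tend to 0.\<close>

lemma locally_uniform_limitI_sequential:
  fixes f :: "nat \<Rightarrow> 'a::metric_space \<Rightarrow> 'b::metric_space"
  assumes compact: "compact (UNIV :: 'a set)" and U: "open U"
    and cont: "continuous_on U h"
    and conv: "\<And>x X m. \<lbrakk>x \<in> U; X \<longlonglongrightarrow> x; filterlim m at_top sequentially\<rbrakk> \<Longrightarrow>
      (\<lambda>j. f (m j) (X j)) \<longlonglongrightarrow> h x"
  shows "locally_uniform_limit U f h"
  unfolding locally_uniform_limit_def
proof
  fix x assume "x \<in> U"
  with U obtain e where e: "e > 0" "cball x e \<subseteq> U"
    by (auto simp: open_contains_cball)
  have "compact (cball x e)"
    using compact_Int_closed[OF compact closed_cball] by simp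
  have "uniform_limit (ball x e) f h sequentially"
  proof (rule ccontr)
    assume "\<not> uniform_limit (ball x e) f h sequentially"
    then obtain d where d: "d > 0" "\<And>N. \<exists>n\<ge>N. \<exists>y\<in>ball x e. \<not> dist (f n y) (h y) < d"
      by (auto simp: uniform_limit_iff eventually_sequentially)
    then obtain m Y where mY: "\<And>N. m N \<ge> N" "\<And>N. Y N \<in> ball x e" "\<And>N. dist (f (m N) (Y N)) (h (Y N)) \<ge> d"
      by (metis not_less)
    have "\<forall>N. Y N \<in> cball x e" using mY(2) by (simp add: less_imp_le)
    then obtain y s where s: "y \<in> cball x e" "strict_mono s" "(Y \<circ> s) \<longlonglongrightarrow> y"
      using \<open>compact (cball x e)\<close> unfolding compact_def by blast
    have "y \<in> U" using s(1) e(2) by blast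
    have "filterlim (\<lambda>j. m (s j)) at_top sequentially"
      unfolding filterlim_at_top eventually_sequentially
      using mY(1) seq_suble[OF s(2)] by (meson order_trans)
    then have "(\<lambda>j. f (m (s j)) ((Y \<circ> s) j)) \<longlonglongrightarrow> h y"
      using conv \<open>y \<in> U\<close> s(3) by blast
    moreover have "isCont h y"
      using cont U \<open>y \<in> U\<close> by (simp add: continuous_on_eq_continuous_at)
    then have "(\<lambda>j. h ((Y \<circ> s) j)) \<longlonglongrightarrow> h y"
      using s(3) by (rule isCont_tendsto_compose)
    ultimately have "(\<lambda>j. dist (f (m (s j)) ((Y \<circ> s) j)) (h ((Y \<circ> s) j))) \<longlonglongrightarrow> dist (h y) (h y)"
      by (rule tendsto_dist)
    moreover have "d \<le> dist (f (m (s j)) ((Y \<circ> s) j)) (h ((Y \<circ> s) j))" for j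
      using mY(3) by simp
    ultimately have "d \<le> dist (h y) (h y)"
      by (intro tendsto_lowerbound) auto
    with d(1) show False by simp
  qed
  moreover have "openin (top_of_set U) (ball x e)"
    using e(2) by (intro open_subset) auto
  ultimately show "\<exists>V. openin (top_of_set U) V \<and> x \<in> V \<and> uniform_limit V f h sequentially"
    using e(1) by auto
qed

lemma locally_uniform_limit_pointwise:
  assumes "locally_uniform_limit U f h" "x \<in> U"
  shows "(\<lambda>n. f n x) \<longlonglongrightarrow> h x"
proof -
  from assms obtain V where "x \<in> V" "uniform_limit V f h sequentially"
    unfolding locally_uniform_limit_def by blast
  then show ?thesis by (metis tendsto_uniform_limitI)
qed

text \<open>Needed because \<open>sp_map\<close> of a rank one matrix agrees with a constant only
  off its kernel.\<close>

lemma locally_uniform_limit_cong: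
  assumes "locally_uniform_limit U f h" "\<And>x. x \<in> U \<Longrightarrow> h x = h' x"
  shows "locally_uniform_limit U f h'"
proof -
  have "uniform_limit V f h' sequentially"
    if "openin (top_of_set U) V" "uniform_limit V f h sequentially" for V
  proof -
    have "\<And>x. x \<in> V \<Longrightarrow> h x = h' x" using assms(2) openin_imp_subset[OF that(1)] by blast
    with that(2) show ?thesis by (simp cong: uniform_limit_cong')
  qed
  with assms(1) show ?thesis unfolding locally_uniform_limit_def by blast
qed

section \<open>Limits of projective transformations\<close>

text \<open>Abstracting from the group lets the same lemmas serve the transformations and their
  inverses, and leaves the scaling of the matrices free, so that they can be normalized.\<close>

definition induced_by :: "(nat \<Rightarrow> cp2 \<Rightarrow> cp2) \<Rightarrow> (nat \<Rightarrow> complex^3^3) \<Rightarrow> bool"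
  where "induced_by f M \<longleftrightarrow> (\<forall>n v. v \<noteq> 0 \<longrightarrow> M n *v v \<noteq> 0 \<and> f n (pt v) = pt (M n *v v))"

text \<open>Convergent representatives \<open>u\<close> of the points reduce the claim to continuity
  of the matrix-vector product. Off the kernel its limit is nonzero, so passing back to points is
  continuous.\<close>

lemma tendsto_induced_by:
  assumes f: "induced_by f M" and M: "M \<longlonglongrightarrow> A"
    and x: "x \<notin> projectivization {v. A *v v = 0}"
    and X: "X \<longlonglongrightarrow> x" and m: "filterlim m at_top sequentially"
  shows "(\<lambda>j. f (m j) (X j)) \<longlonglongrightarrow> sp_map (sp A) x"
proof -
  obtain v where v: "v \<noteq> 0" "x = pt v" by (rule cp2_cases)
  with x have Av: "A *v v \<noteq> 0" by (simp add: pt_in_projectivization_iff subspace_ker)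
  from X v obtain u where u: "\<And>k. u k \<noteq> 0" "\<And>k. X k = pt (u k)" "u \<longlonglongrightarrow> v"
    by (metis tendsto_cp2_lift)
  have "(\<lambda>j. M (m j) *v u j) \<longlonglongrightarrow> A *v v"
    using filterlim_compose[OF M m] u(3) by (intro tendsto_intros)
  then have "(\<lambda>j. pt (M (m j) *v u j)) \<longlonglongrightarrow> pt (A *v v)"
    using Av by (rule tendsto_pt)
  with f u v Av show ?thesis by (simp add: induced_by_def sp_map_sp)
qed

lemma closed_projectivization_ker: "closed (projectivization {v. A *v v = 0})"
proof -
  have "open (- projectivization {v. A *v v = 0})"
    unfolding open_cp2_iff
  proof -
    \<comment> \<open>By \<open>open_cp2_iff\<close>, openness may be tested on the preimage among
      the nonzero vectors.\<close>
    have "{v. v \<noteq> 0 \<and> pt v \<in> - projectivization {v. A *v v = 0}} = {v. A *v v \<noteq> 0}"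
    proof (intro Collect_cong)
      fix v show "v \<noteq> 0 \<and> pt v \<in> - projectivization {v. A *v v = 0} \<longleftrightarrow> A *v v \<noteq> 0"
        by (cases "v = 0") (simp_all add: pt_in_projectivization_iff subspace_ker)
    qed
    moreover have "open {v. A *v v \<noteq> 0}"
      by (intro open_Collect_neq continuous_intros)
    ultimately show "open {v. v \<noteq> 0 \<and> pt v \<in> - projectivization {v. A *v v = 0}}" by simp
  qed
  then show ?thesis by (simp add: closed_def)
qed

lemma locally_uniform_limit_induced_by:
  assumes f: "induced_by f M" and M: "M \<longlonglongrightarrow> A"
  shows "locally_uniform_limit (- projectivization {v. A *v v = 0}) f (sp_map (sp A))"
proof (rule locally_uniform_limitI_sequential[OF compact_cp2])
  show op: "open (- projectivization {v. A *v v = 0})"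
    by (simp add: closed_projectivization_ker open_Compl)
  show "(\<lambda>j. f (m j) (X j)) \<longlonglongrightarrow> sp_map (sp A) x"
    if "x \<in> - projectivization {v. A *v v = 0}" "X \<longlonglongrightarrow> x" "filterlim m at_top sequentially" for x X m
    using tendsto_induced_by[OF f M _ that(2,3)] that(1) by simp
  show "continuous_on (- projectivization {v. A *v v = 0}) (sp_map (sp A))"
    unfolding continuous_on_sequentially comp_def
  proof (intro ballI allI impI, elim conjE)
    fix x and X :: "nat \<Rightarrow> cp2"
    assume x: "x \<in> - projectivization {v. A *v v = 0}" and X: "X \<longlonglongrightarrow> x"
      and XU: "\<forall>n. X n \<in> - projectivization {v. A *v v = 0}"
    obtain v where v: "v \<noteq> 0" "x = pt v" by (rule cp2_cases)
    with x have Av: "A *v v \<noteq> 0" by (simp add: pt_in_projectivization_iff subspace_ker)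
    from X v obtain u where u: "\<And>k. u k \<noteq> 0" "\<And>k. X k = pt (u k)" "u \<longlonglongrightarrow> v"
      by (metis tendsto_cp2_lift)
    have "A *v u k \<noteq> 0" for k
      using XU u(1,2) by (simp add: pt_in_projectivization_iff subspace_ker)
    moreover have "(\<lambda>k. pt (A *v u k)) \<longlonglongrightarrow> pt (A *v v)"
      using u(3) Av by (intro tendsto_pt tendsto_intros)
    ultimately show "(\<lambda>n. sp_map (sp A) (X n)) \<longlonglongrightarrow> sp_map (sp A) x"
      using u(2) v Av by (simp add: sp_map_sp)
  qed
qed

section \<open>Exclusivity\<close>

text \<open>Two different parameters would put \<open>y\<close>, and then also \<open>x\<close>,
  into \<open>S\<close>; so at most one parameter occurs.\<close>

lemma finite_line_Int_subspace:
  fixes S :: "('a::field^'n) set"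
  assumes S: "vec.subspace S" and xy: "x \<notin> S \<or> y \<notin> S"
  shows "finite {t. x + t *s y \<in> S}"
proof -
  have "s = t" if "x + s *s y \<in> S" "x + t *s y \<in> S" for s t
  proof (rule ccontr)
    assume "s \<noteq> t"
    have "(x + s *s y) - (x + t *s y) \<in> S" using S that by (rule vec.subspace_diff)
    then have "(s - t) *s y \<in> S" by (simp add: vec.scale_left_diff_distrib)
    then have "inverse (s - t) *s ((s - t) *s y) \<in> S" using S vec.subspace_scale by blast
    moreover have "inverse (s - t) *s ((s - t) *s y) = y"
      using \<open>s \<noteq> t\<close> by (subst vector_smult_assoc) simp
    ultimately have y: "y \<in> S" by simp
    then have "(x + s *s y) - s *s y \<in> S"
      using S that(1) by (intro vec.subspace_diff vec.subspace_scale) auto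
    with y xy show False by simp
  qed
  then have "\<exists>t. {t. x + t *s y \<in> S} \<subseteq> {t}" by blast
  then show ?thesis using finite_subset by blast
qed

text \<open>Over an infinite field, a line with finitely many parameters in each subspace has a
  point outside all of them. A first line produces \<open>d\<close> outside \<open>P\<close> and
  \<open>W\<close>; a second one, with direction \<open>d\<close> through \<open>c\<close> outside
  \<open>T\<close>, leaves all three.\<close>

lemma subspaces_cover_imp_UNIV:
  fixes P W T :: "('a::field_char_0^'n) set"
  assumes P: "vec.subspace P" and W: "vec.subspace W" and T: "vec.subspace T"
    and cover: "P \<union> W \<union> T = UNIV"
  shows "P = UNIV \<or> W = UNIV \<or> T = UNIV"
proof (rule ccontr)
  assume "\<not> ?thesis"
  then obtain a b c where abc: "a \<notin> P" "b \<notin> W" "c \<notin> T" by blast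
  have new: "\<exists>t. t \<notin> X" if "finite X" for X :: "'a set"
    using that by (rule ex_new_if_finite[OF infinite_UNIV_char_0])
  have "finite ({t. a + t *s b \<in> P} \<union> {t. a + t *s b \<in> W})"
    using P W abc by (simp add: finite_line_Int_subspace)
  from new[OF this] obtain d where d: "d \<notin> P" "d \<notin> W" by blast
  have "finite ({t. c + t *s d \<in> P} \<union> {t. c + t *s d \<in> W} \<union> {t. c + t *s d \<in> T})"
    using P W T d abc(3) by (simp add: finite_line_Int_subspace)
  from new[OF this] obtain t where "c + t *s d \<notin> P \<union> W \<union> T" by blast
  with cover show False by blast
qed

text \<open>Off the line and the point \<open>sp_map S\<close> has the constant value \<open>q\<close>; since space is not a union
  of three proper subspaces, this forces \<open>S\<close> to have rank one.\<close>

lemma constant_limit_excludes_line_image: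
  assumes l: "projective_line l" and const: "locally_uniform_limit (- l) f (\<lambda>_. q)"
    and S: "locally_uniform_limit (- {p}) f (sp_map S)" "sp_ker S = {p}" "projective_line (sp_im S)"
  shows False
proof -
  define A where "A = rep_sp3 S"
  have A: "A \<noteq> 0" "S = sp A" by (simp_all add: A_def)
  obtain W where W: "vec.subspace W" "vec.dim W = 2" "l = projectivization W"
    using l by (auto simp: projective_line_def)
  define K where "K = {v. A *v v = 0}"
  \<comment> \<open>\<open>T\<close> collects the vectors sent to 0 or to a representative of
    \<open>q\<close>. If it is everything, the image of \<open>S\<close> has at most one
    point.\<close>
  define T where "T = {v. A *v v \<in> vec.span {rep_cp2 q}}"
  have K: "vec.subspace K" unfolding K_def by (rule subspace_ker)
  have T: "vec.subspace T"
    unfolding T_def by (auto simp: vec.subspace_def matrix_vector_right_distrib vector_scalar_commute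
        intro: vec.span_zero vec.span_add vec.span_scale)
  have "v \<in> T" if "v \<notin> K" "v \<notin> W" for v
  proof -
    have v: "A *v v \<noteq> 0" "v \<noteq> 0" using that by (auto simp: K_def)
    then have "pt v \<notin> sp_ker S"
      by (simp add: A(2) sp_ker_sp[OF A(1)] pt_in_projectivization_iff subspace_ker)
    then have "(\<lambda>n. f n (pt v)) \<longlonglongrightarrow> sp_map S (pt v)"
      using S(1,2) by (intro locally_uniform_limit_pointwise[OF S(1)]) auto
    moreover have "(\<lambda>n. f n (pt v)) \<longlonglongrightarrow> q"
      using that v W by (intro locally_uniform_limit_pointwise[OF const]) (simp add: pt_in_projectivization_iff)
    ultimately have "sp_map S (pt v) = q" by (rule LIMSEQ_unique)
    then have "pt (A *v v) = pt (rep_cp2 q)" using v by (simp add: A(2) sp_map_sp)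
    then obtain c where "A *v v = c *s rep_cp2 q" using v by (metis pt_eq_iff rep_cp2_nonzero)
    then show ?thesis unfolding T_def by (simp add: vec.span_scale vec.span_base)
  qed
  then have "K \<union> W \<union> T = UNIV" by blast
  then have "K = UNIV \<or> W = UNIV \<or> T = UNIV"
    by (rule subspaces_cover_imp_UNIV[OF K W(1) T])
  moreover have "K \<noteq> UNIV" using A(1) by (auto simp: K_def matrix_eq)
  moreover have "W \<noteq> UNIV" using W(2) vec_dim_card[where 'a=complex and 'n=3] by (auto simp del: vec.dim_UNIV)
  ultimately have "T = UNIV" by blast
  then have "range ((*v) A) \<subseteq> vec.span {rep_cp2 q}" by (auto simp: T_def)
  then have "sp_im S \<subseteq> projectivization (vec.span {rep_cp2 q})"
    by (auto simp: A(2) sp_im_sp[OF A(1)] projectivization_def)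
  then show False
    using S(3) projective_line_not_singleton by (simp add: projectivization_span_singleton)
qed

section \<open>Destinations\<close>

text \<open>A destination only prescribes the sequence of points along the subsequence \<open>m\<close>; it is filled
  up with the constant \<open>x\<close>.\<close>

lemma destinationsI:
  assumes m: "strict_mono m" and Y: "Y \<longlonglongrightarrow> x"
    and y: "(\<lambda>j. act (g (m j)) (Y j)) \<longlonglongrightarrow> y"
  shows "y \<in> destinations g x"
proof -
  define X where "X n = (if n \<in> range m then Y (inv_into UNIV m n) else x)" for n
  have Xm: "X (m j) = Y j" for j
    using strict_mono_imp_inj_on[OF m] by (simp add: X_def)
  have "X \<longlonglongrightarrow> x"
  proof (rule metric_LIMSEQ_I)
    fix e :: real assume "e > 0"
    then obtain K where K: "\<And>k. k \<ge> K \<Longrightarrow> dist (Y k) x < e"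
      using metric_LIMSEQ_D[OF Y] by blast
    have "dist (X n) x < e" if n: "n \<ge> m K" for n
    proof (cases "n \<in> range m")
      case True
      then obtain k where k: "n = m k" by blast
      with n m have "k \<ge> K" by (simp add: strict_mono_less_eq)
      with K k Xm show ?thesis by simp
    qed (use \<open>e > 0\<close> in \<open>simp add: X_def\<close>)
    then show "\<exists>N. \<forall>n\<ge>N. dist (X n) x < e" by blast
  qed
  moreover have "(\<lambda>j. act (g (m j)) (X (m j))) \<longlonglongrightarrow> y" using y by (simp add: Xm)
  moreover have "filterlim m at_top sequentially" using m by (rule filterlim_subseq)
  ultimately show ?thesis unfolding destinations_def by blast
qed

text \<open>If a destination \<open>y\<close> were off the kernel of \<open>B\<close>, applying the
  inverses \<open>h\<close> would show that points tending to \<open>x\<close> also tend to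
  \<open>p_plus\<close>. Conversely, \<open>p_minus\<close> is reached by points off the kernel of
  \<open>A\<close> that approach \<open>x\<close> slowly enough, and any other point of the line by
  pulling back points near it.\<close>

lemma destinations_of_flag:
  assumes f: "induced_by (\<lambda>n. act (g n)) M" and M: "M \<longlonglongrightarrow> A"
    and h: "induced_by h N" and N: "N \<longlonglongrightarrow> B"
    and hf: "\<And>n x. h n (act (g n) x) = x" and fh: "\<And>n x. act (g n) (h n x) = x"
    and AB: "A ** B = 0" and BA: "B ** A = 0"
    and kerA: "vec.dim {v. A *v v = 0} = 2"
    and imA: "projectivization (range ((*v) A)) = {p_minus}"
    and imB: "projectivization (range ((*v) B)) = {p_plus}"
    and x: "x \<in> projectivization {v. A *v v = 0}" "x \<noteq> p_plus"
  shows "destinations g x = projectivization {v. B *v v = 0}"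
proof (intro equalityI subsetI)
  have sp_map_B: "sp_map (sp B) y = p_plus" if "y \<notin> projectivization {v. B *v v = 0}" for y
    using sp_map_in_projectivization_range[OF that] imB by simp
  fix y assume "y \<in> destinations g x"
  then obtain X m where X: "X \<longlonglongrightarrow> x" and m: "filterlim m at_top sequentially"
    and y: "(\<lambda>j. act (g (m j)) (X (m j))) \<longlonglongrightarrow> y"
    by (auto simp: destinations_def)
  show "y \<in> projectivization {v. B *v v = 0}"
  proof (rule ccontr)
    assume ny: "y \<notin> projectivization {v. B *v v = 0}"
    have "(\<lambda>j. h (m j) (act (g (m j)) (X (m j)))) \<longlonglongrightarrow> p_plus"
      using tendsto_induced_by[OF h N ny y m] sp_map_B[OF ny] by simp
    then have "(\<lambda>j. X (m j)) \<longlonglongrightarrow> p_plus" by (simp add: hf)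
    moreover have "(\<lambda>j. X (m j)) \<longlonglongrightarrow> x" using X m by (rule filterlim_compose)
    ultimately show False using x(2) LIMSEQ_unique by blast
  qed
next
  have sp_map_A: "sp_map (sp A) z = p_minus" if "z \<notin> projectivization {v. A *v v = 0}" for z
    using sp_map_in_projectivization_range[OF that] imA by simp
  obtain v where v: "v \<noteq> 0" "x = pt v" by (rule cp2_cases)
  with x(1) have Av: "A *v v = 0" by (simp add: pt_in_projectivization_iff subspace_ker)
  fix y assume yB: "y \<in> projectivization {v. B *v v = 0}"
  then obtain w where w: "w \<noteq> 0" "y = pt w" "B *v w = 0" by (auto simp: projectivization_def)
  show "y \<in> destinations g x"
  proof (cases "y = p_minus")
    case True
    obtain a where a: "A *v a \<noteq> 0"
      using imA by (auto simp: projectivization_def set_eq_iff)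
    \<comment> \<open>Each \<open>c k\<close> is off the kernel of \<open>A\<close>, so for fixed
      \<open>k\<close> its images tend to \<open>p_minus\<close>. A diagonal choice of increasing
      indices \<open>m k\<close> then makes the images of the moving points \<open>pt (c k)\<close>
      tend to \<open>p_minus\<close> as well.\<close>
    define c where "c k = v + of_real (inverse (real (Suc k))) *s a" for k
    have Ac: "A *v c k \<noteq> 0" for k
      using a Av by (simp add: c_def matrix_vector_right_distrib vector_scalar_commute del: of_nat_Suc)
    then have c0: "c k \<noteq> 0" for k by (metis matrix_vector_mult_0_right)
    have "(\<lambda>k. of_real (inverse (real (Suc k)))) \<longlonglongrightarrow> (of_real 0 :: complex)"
      using LIMSEQ_inverse_real_of_nat by (rule tendsto_of_real)
    then have "c \<longlonglongrightarrow> v + of_real 0 *s a"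
      unfolding c_def[abs_def] by (intro tendsto_add tendsto_vector_smult tendsto_const)
    then have c: "c \<longlonglongrightarrow> v" by simp
    have "(\<lambda>n. act (g n) (pt (c k))) \<longlonglongrightarrow> p_minus" for k
      using tendsto_induced_by[OF f M _ tendsto_const filterlim_ident, of "pt (c k)"]
        sp_map_A[of "pt (c k)"] Ac c0 by (simp add: pt_in_projectivization_iff subspace_ker)
    then have "\<exists>n>N. dist (act (g n) (pt (c k))) p_minus < inverse (real (Suc k))" for k N
      using metric_LIMSEQ_D[of "\<lambda>n. act (g n) (pt (c k))" p_minus "inverse (real (Suc k))"]
      by (metis inverse_positive_iff_positive max.cobounded1 max.cobounded2 less_eq_Suc_le
          of_nat_0_less_iff zero_less_Suc)
    then have "\<exists>m. \<forall>k. dist (act (g (m k)) (pt (c k))) p_minus < inverse (real (Suc k)) \<and> m k < m (Suc k)"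
      by (intro dependent_nat_choice) blast+
    then obtain m where m: "\<And>k. m k < m (Suc k)"
      "\<And>k. dist (act (g (m k)) (pt (c k))) p_minus < inverse (real (Suc k))"
      by blast
    have "(\<lambda>k. act (g (m k)) (pt (c k))) \<longlonglongrightarrow> p_minus"
      by (rule metric_tendsto_imp_tendsto[OF LIMSEQ_inverse_real_of_nat])
        (use m(2) in \<open>auto simp: less_imp_le\<close>)
    moreover have "(\<lambda>k. pt (c k)) \<longlonglongrightarrow> x" using tendsto_pt[OF c v(1)] v(2) by simp
    moreover have "strict_mono m" using m(1) by (simp add: strict_mono_Suc_iff)
    ultimately show ?thesis unfolding True by (intro destinationsI)
  next
    case False
    \<comment> \<open>The line \<open>\<phi> = 0\<close> passes through \<open>x\<close> but not through \<open>p_plus = pt b\<close>. Its image under \<open>g n\<close> is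
      the line \<open>\<phi> (N n *v _) = 0\<close>, which tends to the kernel of \<open>B\<close> because \<open>\<phi> (B *v _)\<close> does not
      vanish identically; \<open>w' n\<close> moves \<open>w\<close> into it. As \<open>g n\<close> tends to \<open>p_minus \<noteq> y\<close> off the kernel
      of \<open>A\<close>, the preimages of \<open>pt (w' n)\<close> can only accumulate where \<open>\<phi> = 0\<close> meets that kernel,
      namely at \<open>x\<close>.\<close>
    obtain b where b: "b \<in> range ((*v) B)" "b \<noteq> 0" "p_plus = pt b"
      using imB by (auto simp: projectivization_def set_eq_iff)
    have Ab: "A *v b = 0" using b(1) AB by (auto simp: matrix_vector_mul_assoc)
    \<comment> \<open>The projection onto the span of \<open>v\<close> fixes only the multiples of
      \<open>v\<close>, and \<open>b\<close> is not one of them since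
      \<open>x \<noteq> p_plus\<close>. Some coordinate of projection minus identity therefore is a
      functional \<phi> that kills \<open>v\<close> but not \<open>b\<close>.\<close>
    have "line_projection v *v b \<noteq> b"
    proof
      assume "line_projection v *v b = b"
      then obtain c where c: "b = c *s v" by (metis line_projection_mult_vec)
      with b(2) have "c \<noteq> 0" by auto
      with c b(3) v(2) x(2) show False by simp
    qed
    then obtain i where i: "(line_projection v *v b) $ i \<noteq> b $ i" by (auto simp: vec_eq_iff)
    define \<phi> where "\<phi> z = (line_projection v *v z) $ i - z $ i" for z
    have \<phi>_add: "\<phi> (y + z) = \<phi> y + \<phi> z" and \<phi>_diff: "\<phi> (y - z) = \<phi> y - \<phi> z"
      and \<phi>_smult: "\<phi> (c *s z) = c * \<phi> z" for c y z
      by (simp_all add: \<phi>_def matrix_vector_right_distrib matrix_vector_mult_diff_distrib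
          vector_scalar_commute algebra_simps)
    have \<phi>_tendsto: "(\<lambda>k. \<phi> (u k)) \<longlonglongrightarrow> \<phi> z" if "u \<longlonglongrightarrow> z" for u z
      unfolding \<phi>_def using that by (intro tendsto_intros)
    have \<phi>v: "\<phi> v = 0" using v(1) by (simp add: \<phi>_def line_projection_self)
    have \<phi>b: "\<phi> b \<noteq> 0" using i by (simp add: \<phi>_def)
    obtain z where z: "b = B *v z" using b(1) by blast
    \<comment> \<open>The coefficient solves \<phi> \<open>(N n *v w' n) = 0\<close> whenever the
      denominator is nonzero, which holds for all large \<open>n\<close>. It tends to 0 because
      \<open>B *v w = 0\<close>.\<close>
    define w' where "w' n = w - (\<phi> (N n *v w) / \<phi> (N n *v z)) *s z" for n
    have lim_w: "(\<lambda>n. \<phi> (N n *v w)) \<longlonglongrightarrow> \<phi> (B *v w)"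
      and lim_z: "(\<lambda>n. \<phi> (N n *v z)) \<longlonglongrightarrow> \<phi> (B *v z)"
      using N by (auto intro!: \<phi>_tendsto tendsto_intros)
    have "\<phi> (B *v z) \<noteq> 0" using \<phi>b z by simp
    have "\<phi> (B *v w) = 0" using w(3) \<phi>_smult[of 0] by simp
    have "(\<lambda>n. \<phi> (N n *v w) / \<phi> (N n *v z)) \<longlonglongrightarrow> \<phi> (B *v w) / \<phi> (B *v z)"
      using lim_w lim_z \<open>\<phi> (B *v z) \<noteq> 0\<close> by (rule tendsto_divide)
    then have quot: "(\<lambda>n. \<phi> (N n *v w) / \<phi> (N n *v z)) \<longlonglongrightarrow> 0"
      by (simp add: \<open>\<phi> (B *v w) = 0\<close>)
    have w'_lim: "w' \<longlonglongrightarrow> w"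
    proof -
      have "w' \<longlonglongrightarrow> w - 0 *s z"
        unfolding w'_def[abs_def] using quot by (intro tendsto_diff tendsto_vector_smult tendsto_const)
      then show ?thesis by simp
    qed
    have "\<forall>\<^sub>F n in sequentially. \<phi> (N n *v z) \<noteq> 0"
      using lim_z \<open>\<phi> (B *v z) \<noteq> 0\<close> by (rule tendsto_imp_eventually_ne)
    then have \<phi>w': "\<forall>\<^sub>F n in sequentially. \<phi> (N n *v w' n) = 0"
      by eventually_elim
        (simp add: w'_def matrix_vector_mult_diff_distrib vector_scalar_commute \<phi>_diff \<phi>_smult)
    have w'0: "\<forall>\<^sub>F n in sequentially. w' n \<noteq> 0"
      using w'_lim w(1) by (rule tendsto_imp_eventually_ne)
    define y' where "y' n = pt (w' n)" for n
    have y': "y' \<longlonglongrightarrow> y" unfolding y'_def w(2) by (rule tendsto_pt[OF w'_lim w(1)])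
    have "\<exists>u. norm u = 1 \<and> h n (y' n) = pt u \<and> (w' n \<noteq> 0 \<longrightarrow> \<phi> (N n *v w' n) = 0 \<longrightarrow> \<phi> u = 0)" for n
    proof -
      have "\<exists>u. u \<noteq> 0 \<and> h n (y' n) = pt u \<and> (w' n \<noteq> 0 \<longrightarrow> u = N n *v w' n)"
        \<comment> \<open>Where \<open>w' n = 0\<close>, any representative will do; this occurs for
          finitely many \<open>n\<close> only.\<close>
        using h by (intro exI[of _ "if w' n = 0 then rep_cp2 (h n (y' n)) else N n *v w' n"])
          (auto simp: induced_by_def y'_def)
      then obtain u where u: "u \<noteq> 0" "h n (y' n) = pt u" "w' n \<noteq> 0 \<longrightarrow> u = N n *v w' n" by blast
      have "norm (sgn u) = 1" using u(1) by (simp add: norm_sgn)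
      moreover have "pt (sgn u) = pt u" "\<phi> u = 0 \<longrightarrow> \<phi> (sgn u) = 0"
        using u(1) by (simp_all add: sgn_div_norm scaleR_eq_smult \<phi>_smult)
      ultimately have "norm (sgn u) = 1 \<and> h n (y' n) = pt (sgn u) \<and>
          (w' n \<noteq> 0 \<longrightarrow> \<phi> (N n *v w' n) = 0 \<longrightarrow> \<phi> (sgn u) = 0)"
        using u(2,3) by auto
      then show ?thesis by blast
    qed
    then obtain u where u: "\<And>n. norm (u n) = 1" "\<And>n. h n (y' n) = pt (u n)"
      "\<And>n. w' n \<noteq> 0 \<Longrightarrow> \<phi> (N n *v w' n) = 0 \<Longrightarrow> \<phi> (u n) = 0"
      by metis
    have "\<forall>n. u n \<in> sphere 0 1" using u(1) by simp
    then obtain u' s where s: "u' \<in> sphere 0 1" "strict_mono s" "(u \<circ> s) \<longlonglongrightarrow> u'"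
      using compact_sphere[of "0 :: complex^3" 1] unfolding compact_def by blast
    have s_lim: "filterlim s at_top sequentially" using s(2) by (rule filterlim_subseq)
    have u'0: "u' \<noteq> 0" using s(1) by auto
    have u'_lim: "(\<lambda>k. h (s k) (y' (s k))) \<longlonglongrightarrow> pt u'"
      using tendsto_pt[OF s(3) u'0] u(2) by simp
    have y'_lim: "(\<lambda>k. act (g (s k)) (h (s k) (y' (s k)))) \<longlonglongrightarrow> y"
      using filterlim_compose[OF y' s_lim] by (simp add: fh)
    have Au': "A *v u' = 0"
    proof (rule ccontr)
      assume "A *v u' \<noteq> 0"
      then have n: "pt u' \<notin> projectivization {v. A *v v = 0}"
        using u'0 by (simp add: pt_in_projectivization_iff subspace_ker)
      have "(\<lambda>k. act (g (s k)) (h (s k) (y' (s k)))) \<longlonglongrightarrow> p_minus"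
        using tendsto_induced_by[OF f M n u'_lim s_lim] sp_map_A[OF n] by simp
      with y'_lim False show False using LIMSEQ_unique by blast
    qed
    have "\<phi> u' = 0"
    proof -
      have "\<forall>\<^sub>F n in sequentially. \<phi> (u n) = 0"
        using \<phi>w' w'0 by eventually_elim (rule u(3))
      then have "\<forall>\<^sub>F k in sequentially. \<phi> ((u \<circ> s) k) = 0"
        unfolding comp_def using s_lim by (rule eventually_compose_filterlim)
      then show ?thesis
        by (rule LIMSEQ_unique[OF \<phi>_tendsto[OF s(3)] tendsto_eventually])
    qed
    \<comment> \<open>Both \<open>v\<close> and \<open>b\<close> lie in the two-dimensional kernel
      of \<open>A\<close>, and they are independent because \<phi> separates them.\<close>
    moreover have "u' \<in> vec.span {v, b}"
    proof -
      have "b \<notin> vec.span {v}"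
      proof
        assume "b \<in> vec.span {v}"
        then obtain c where "b = c *s v" by (auto simp: vec.span_singleton)
        with \<phi>b \<phi>v show False by (simp add: \<phi>_smult)
      qed
      then have "vec.independent {b, v}"
        using v(1) by (intro vec.independent_insertI) (auto simp: vec.dependent_single vec.independent_empty)
      moreover have "b \<noteq> v" using \<phi>b \<phi>v by auto
      ultimately have "{v. A *v v = 0} \<subseteq> vec.span {b, v}"
        using kerA Ab Av by (intro vec.card_ge_dim_independent) auto
      with Au' show ?thesis by (auto simp: insert_commute)
    qed
    then obtain c d where cd: "u' = c *s v + d *s b"
      by (auto simp: vec.span_insert vec.span_singleton algebra_simps)
    ultimately have "d = 0" using \<phi>v \<phi>b by (simp add: \<phi>_add \<phi>_smult)
    with cd u'0 have "c \<noteq> 0" "u' = c *s v" by auto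
    then have "pt u' = x" using v(2) by simp
    with u'_lim y'_lim s(2) show ?thesis by (intro destinationsI) simp_all
  qed
qed

section \<open>Discrete sequences\<close>

lemma coset_mult:
  assumes "det A = 1" "det B = 1"
  shows "(SL3_center #>\<^bsub>SL3\<^esub> A) \<otimes>\<^bsub>PSL3\<^esub> (SL3_center #>\<^bsub>SL3\<^esub> B) = SL3_center #>\<^bsub>SL3\<^esub> (A ** B)"
  using normal.rcos_sum[OF normal_SL3_center, of A B] assms by (simp add: PSL3_def FactGroup_def)

lemma coset_one: "SL3_center #>\<^bsub>SL3\<^esub> mat 1 = \<one>\<^bsub>PSL3\<^esub>"
  by (simp add: PSL3_def FactGroup_def coset_SL3_center) (simp add: SL3_center_def)

lemma coset_inverse:
  assumes "det A = 1" "det B = 1" "B ** A = mat 1"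
  shows "inv\<^bsub>PSL3\<^esub> (SL3_center #>\<^bsub>SL3\<^esub> A) = SL3_center #>\<^bsub>SL3\<^esub> B"
  using assms by (intro group.inv_equality[OF group_PSL3])
    (auto simp: coset_mult coset_one carrier_PSL3)

lemma det_1_inverseE:
  fixes A :: "'a::field^'n^'n"
  assumes "det A = 1"
  obtains B where "det B = 1" "A ** B = mat 1" "B ** A = mat 1"
proof -
  have "invertible A" using assms by (simp add: invertible_det_nz)
  then obtain B where B: "A ** B = mat 1" "B ** A = mat 1" by (auto simp: invertible_def)
  have "det A * det B = 1" using B(1) by (metis det_mul det_I)
  with assms B that show thesis by simp
qed

text \<open>The limit has determinant 1, so the inverses converge too and
  \<open>A (Suc n) ** B n\<close> tends to the identity matrix. The classes of these quotients lie
  in \<open>G\<close>, where the identity is isolated, so some quotient is trivial.\<close>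

lemma discrete_subgroup_convergent:
  assumes G: "discrete_subgroup_PSL3 G" and det: "\<And>n. det (A n) = 1"
    and AG: "\<And>n. SL3_center #>\<^bsub>SL3\<^esub> A n \<in> G" and lim: "A \<longlonglongrightarrow> L"
  shows "\<exists>n. SL3_center #>\<^bsub>SL3\<^esub> A (Suc n) = SL3_center #>\<^bsub>SL3\<^esub> A n"
proof -
  have sub: "subgroup G PSL3" and disc: "subtopology PSL3_topology G = discrete_topology G"
    using G by (auto simp: discrete_subgroup_PSL3_def)
  have "(\<lambda>n. det (A n)) \<longlonglongrightarrow> det L" using lim by (rule tendsto_det)
  then have "det L = 1" by (simp add: det LIMSEQ_const_iff)
  then obtain L' where L': "L ** L' = mat 1" by (rule det_1_inverseE)
  have "\<exists>B. det B = 1 \<and> A n ** B = mat 1 \<and> B ** A n = mat 1" for n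
    using det_1_inverseE[OF det] by metis
  then obtain B where B: "\<And>n. det (B n) = 1" "\<And>n. A n ** B n = mat 1" "\<And>n. B n ** A n = mat 1"
    by metis
  have "B \<longlonglongrightarrow> L'" using lim det B(2) L' by (rule tendsto_matrix_right_inverse)
  then have C: "(\<lambda>n. A (Suc n) ** B n) \<longlonglongrightarrow> mat 1"
    unfolding L'[symmetric] by (intro tendsto_matrix_matrix_mult LIMSEQ_Suc lim)
  have "openin (subtopology PSL3_topology G) {\<one>\<^bsub>PSL3\<^esub>}"
    using subgroup.one_closed[OF sub] by (simp add: disc)
  then obtain U where U: "openin PSL3_topology U" "U \<inter> G = {\<one>\<^bsub>PSL3\<^esub>}"
    by (auto simp: openin_subtopology)
  then have U': "U \<subseteq> carrier PSL3" "openin (top_of_set (carrier SL3)) (\<Union>U)"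
    by (simp_all add: openin_PSL3_topology)
  \<comment> \<open>The isolating neighbourhood \<open>U\<close> of the identity is lifted to an
    open set of matrices, where the convergence takes place.\<close>
  then obtain T where T: "open T" "\<Union>U = carrier SL3 \<inter> T" by (auto simp: openin_open)
  have "mat 1 \<in> \<Union>U"
    using U(2) by (auto simp: Union_PSL3[OF U'(1)] coset_one det_I)
  with T have "mat 1 \<in> T" by blast
  with C T(1) have "\<forall>\<^sub>F n in sequentially. A (Suc n) ** B n \<in> T"
    by (rule topological_tendstoD)
  then obtain n where n: "A (Suc n) ** B n \<in> T"
    using eventually_happens'[OF sequentially_bot] by blast
  have "A (Suc n) ** B n \<in> \<Union>U"
    using n by (simp add: T(2) det B(1) det_mul)
  then have "SL3_center #>\<^bsub>SL3\<^esub> (A (Suc n) ** B n) \<in> U" by (simp add: Union_PSL3[OF U'(1)])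
  moreover have "SL3_center #>\<^bsub>SL3\<^esub> (A (Suc n) ** B n) \<in> G"
  proof -
    have "SL3_center #>\<^bsub>SL3\<^esub> B n = inv\<^bsub>PSL3\<^esub> (SL3_center #>\<^bsub>SL3\<^esub> A n)"
      using coset_inverse[of "A n" "B n"] det B by simp
    then have "SL3_center #>\<^bsub>SL3\<^esub> B n \<in> G"
      using subgroup.m_inv_closed[OF sub AG] by simp
    then show ?thesis
      using subgroup.m_closed[OF sub AG[of "Suc n"]] coset_mult[OF det B(1)] by metis
  qed
  ultimately have "SL3_center #>\<^bsub>SL3\<^esub> (A (Suc n) ** B n) = SL3_center #>\<^bsub>SL3\<^esub> mat 1"
    using U(2) by (auto simp: coset_one)
  then have "SL3_center #>\<^bsub>SL3\<^esub> ((A (Suc n) ** B n) ** A n) = SL3_center #>\<^bsub>SL3\<^esub> (mat 1 ** A n)"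
    using coset_mult[of "A (Suc n) ** B n" "A n"] coset_mult[of "mat 1" "A n"] det B(1)
    by (simp add: det_mul det_I)
  then show ?thesis by (auto simp: matrix_mul_assoc[symmetric] B(3))
qed

text \<open>Otherwise infinitely many of the matrices stay in a ball; a convergent subsequence then
  has two consecutive terms with equal classes, against injectivity.\<close>

lemma discrete_subgroup_norm_at_top:
  assumes G: "discrete_subgroup_PSL3 G" and det: "\<And>n. det (A n) = 1"
    and AG: "\<And>n. SL3_center #>\<^bsub>SL3\<^esub> A n \<in> G"
    and inj: "inj (\<lambda>n. SL3_center #>\<^bsub>SL3\<^esub> A n)"
  shows "filterlim (\<lambda>n. norm (A n)) at_top sequentially"
  unfolding filterlim_at_top
proof (rule allI, rule ccontr)
  fix Z assume "\<not> (\<forall>\<^sub>F n in sequentially. Z \<le> norm (A n))"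
  then have "infinite {n. \<not> Z \<le> norm (A n)}"
    by (simp add: cofinite_eq_sequentially[symmetric] eventually_cofinite)
  then obtain s :: "nat \<Rightarrow> nat" where s: "strict_mono s" "\<And>n. s n \<in> {n. \<not> Z \<le> norm (A n)}"
    using infinite_enumerate by blast
  have "\<forall>n. (A \<circ> s) n \<in> cball 0 Z" using s(2) by (simp add: not_le less_imp_le)
  then obtain L t where t: "strict_mono t" "((A \<circ> s) \<circ> t) \<longlonglongrightarrow> L"
    using compact_cball[of "0 :: complex^3^3" Z] unfolding compact_def by blast
  have "\<exists>n. SL3_center #>\<^bsub>SL3\<^esub> ((A \<circ> s) \<circ> t) (Suc n) = SL3_center #>\<^bsub>SL3\<^esub> ((A \<circ> s) \<circ> t) n"
    by (rule discrete_subgroup_convergent[OF G _ _ t(2)]) (simp_all add: det AG)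
  then obtain n where "SL3_center #>\<^bsub>SL3\<^esub> A (s (t (Suc n))) = SL3_center #>\<^bsub>SL3\<^esub> A (s (t n))" by auto
  then have "s (t (Suc n)) = s (t n)" by (rule injD[OF inj])
  then show False using strict_mono_eq[OF s(1)] strict_mono_eq[OF t(1)] by simp
qed

section \<open>Limit matrices of rank one and two, and the case distinction\<close>

lemma locally_uniform_limit_constant:
  assumes f: "induced_by f M" and M: "M \<longlonglongrightarrow> A" and im: "projectivization (range ((*v) A)) = {p}"
  shows "locally_uniform_limit (- projectivization {v. A *v v = 0}) f (\<lambda>_. p)"
proof (rule locally_uniform_limit_cong[OF locally_uniform_limit_induced_by[OF f M]])
  show "sp_map (sp A) x = p" if "x \<in> - projectivization {v. A *v v = 0}" for x
    using sp_map_in_projectivization_range[of x A] that im by simp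
qed

text \<open>The vanishing products put each range inside the other kernel, and counting dimensions
  turns both inclusions into equalities. Exchanging the roles of \<open>f\<close> and
  \<open>h\<close> yields the remaining mixed case.\<close>

lemma rank_2_limit:
  assumes f: "induced_by f M" and M: "M \<longlonglongrightarrow> A" and h: "induced_by h N" and N: "N \<longlonglongrightarrow> B"
    and AB: "A ** B = 0" and BA: "B ** A = 0"
    and dimA: "vec.dim (range ((*v) A)) = 2" and dimB: "vec.dim (range ((*v) B)) = 1"
  shows "\<exists>p l S. projective_line l \<and> sp_ker S = {p} \<and> sp_im S = l \<and>
    locally_uniform_limit (- {p}) f (sp_map S) \<and> locally_uniform_limit (- l) h (\<lambda>_. p)"
proof -
  have "A \<noteq> 0" using dimA by auto
  have kerA: "vec.dim {v. A *v v = 0} = 1" and kerB: "vec.dim {v. B *v v = 0} = 2"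
    using vec_rank_nullity[of A] vec_rank_nullity[of B] dimA dimB by simp_all
  have "range ((*v) B) = {v. A *v v = 0}"
    using AB by (intro vec.subspace_dim_equal subspace_range subspace_ker)
      (auto simp: matrix_vector_mul_assoc dimB kerA)
  moreover have "range ((*v) A) = {v. B *v v = 0}"
    using BA by (intro vec.subspace_dim_equal subspace_range subspace_ker)
      (auto simp: matrix_vector_mul_assoc dimA kerB)
  moreover obtain p where p: "projectivization {v. A *v v = 0} = {p}"
    using projectivization_dim_1[OF subspace_ker kerA] by blast
  ultimately have "sp_ker (sp A) = {p}" "sp_im (sp A) = projectivization {v. B *v v = 0}"
    "locally_uniform_limit (- projectivization {v. B *v v = 0}) h (\<lambda>_. p)"
    using \<open>A \<noteq> 0\<close> locally_uniform_limit_constant[OF h N] by (simp_all add: sp_ker_sp sp_im_sp)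
  moreover have "projective_line (projectivization {v. B *v v = 0})"
    using kerB subspace_ker unfolding projective_line_def by blast
  moreover have "locally_uniform_limit (- {p}) f (sp_map (sp A))"
    using locally_uniform_limit_induced_by[OF f M] by (simp add: p)
  ultimately show ?thesis by blast
qed

lemma sgn_matrix_vector_mult:
  "sgn (A :: complex^'n^'m) *v v = of_real (inverse (norm A)) *s (A *v v)"
  by (simp add: sgn_div_norm vec_eq_iff matrix_vector_mult_def sum_distrib_left)
    (simp add: scaleR_conv_of_real mult.assoc)

lemma induced_by_act_coset:
  assumes "\<And>n. det (A n) = 1"
  shows "induced_by (\<lambda>n. act (SL3_center #>\<^bsub>SL3\<^esub> A n)) (\<lambda>n. sgn (A n))"
proof -
  have "A n *v v \<noteq> 0" if "v \<noteq> 0" for n v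
    using det_1_inverseE[OF assms] that
    by (metis matrix_vector_mul_assoc matrix_vector_mul_lid matrix_vector_mult_0_right)
  moreover have "A n \<noteq> 0" for n using assms[of n] by (auto simp: det_3)
  ultimately show ?thesis
    by (simp add: induced_by_def act_coset assms sgn_matrix_vector_mult)
qed

lemma act_inverse:
  assumes "det A = 1" "det B = 1" "B ** A = mat 1"
  shows "act (SL3_center #>\<^bsub>SL3\<^esub> B) (act (SL3_center #>\<^bsub>SL3\<^esub> A) x) = x"
proof -
  obtain v where v: "v \<noteq> 0" "x = pt v" by (rule cp2_cases)
  have BA: "B *v (A *v v) = v" using assms(3) by (simp add: matrix_vector_mul_assoc)
  with v(1) have "A *v v \<noteq> 0" by auto
  with BA v assms show ?thesis by (simp add: act_coset)
qed

text \<open>The two limits of \<open>g n\<close> itself are incompatible: one is constant off a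
  line, the other has a line as image.\<close>

lemma full_flag_not_point_to_line: "full_flag_case g \<Longrightarrow> \<not> point_to_line_case g"
  unfolding full_flag_case_def point_to_line_case_def full_flag_def
  using constant_limit_excludes_line_image by blast

text \<open>Here the incompatible limits are those of the inverses.\<close>

lemma full_flag_not_line_to_point: "full_flag_case g \<Longrightarrow> \<not> line_to_point_case g"
  unfolding full_flag_case_def line_to_point_case_def full_flag_def
  using constant_limit_excludes_line_image by blast

lemma point_to_line_not_line_to_point: "point_to_line_case g \<Longrightarrow> \<not> line_to_point_case g"
  unfolding point_to_line_case_def line_to_point_case_def
  using constant_limit_excludes_line_image by blast

lemma discrete_sequence_trichotomy:
  fixes g :: "nat \<Rightarrow> (complex^3^3) set"
  assumes G: "discrete_subgroup_PSL3 G" and gG: "\<And>n. g n \<in> G" and inj: "inj g"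
  shows "\<exists>r. strict_mono r \<and>
    (full_flag_case (g \<circ> r) \<or> point_to_line_case (g \<circ> r) \<or> line_to_point_case (g \<circ> r))"
proof -
  have sub: "subgroup G PSL3" using G by (simp add: discrete_subgroup_PSL3_def)
  have "\<exists>A. det A = 1 \<and> g n = SL3_center #>\<^bsub>SL3\<^esub> A" for n
    using subgroup.mem_carrier[OF sub gG[of n]] by (auto simp: carrier_PSL3)
  then obtain A where A: "\<And>n. det (A n) = 1" "\<And>n. g n = SL3_center #>\<^bsub>SL3\<^esub> A n" by metis
  have "\<exists>B. det B = 1 \<and> A n ** B = mat 1 \<and> B ** A n = mat 1" for n
    using det_1_inverseE[OF A(1)] by metis
  then obtain B where B: "\<And>n. det (B n) = 1" "\<And>n. A n ** B n = mat 1" "\<And>n. B n ** A n = mat 1"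
    by metis
  have inv_g: "inv\<^bsub>PSL3\<^esub> (g n) = SL3_center #>\<^bsub>SL3\<^esub> B n" for n
    by (simp add: A coset_inverse B)
  have normA: "filterlim (\<lambda>n. norm (A n)) at_top sequentially"
    using gG inj A(2) by (intro discrete_subgroup_norm_at_top[OF G A(1)]) (auto simp: inj_def)
  have "inj (\<lambda>n. inv\<^bsub>PSL3\<^esub> (g n))"
    using inj subgroup.mem_carrier[OF sub gG] group.inv_inv[OF group_PSL3] unfolding inj_def by metis
  then have normB: "filterlim (\<lambda>n. norm (B n)) at_top sequentially"
    using subgroup.m_inv_closed[OF sub gG] inv_g
    by (intro discrete_subgroup_norm_at_top[OF G B(1)]) (auto simp: inj_def)
  have nz: "A n \<noteq> 0" "B n \<noteq> 0" for n using A(1)[of n] B(1)[of n] by (auto simp: det_3)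
  \<comment> \<open>Compactness of the product gives one subsequence along which both normalized
    sequences converge.\<close>
  have "compact (sphere 0 1 \<times> sphere 0 1 :: ((complex^3^3) \<times> (complex^3^3)) set)"
    by (intro compact_Times compact_sphere)
  moreover have "\<forall>n. (sgn (A n), sgn (B n)) \<in> sphere 0 1 \<times> sphere 0 1"
    using nz by (simp add: norm_sgn)
  ultimately obtain L r where L: "L \<in> sphere 0 1 \<times> sphere 0 1" and r: "strict_mono r"
    and lim: "((\<lambda>n. (sgn (A n), sgn (B n))) \<circ> r) \<longlonglongrightarrow> L"
    unfolding compact_def by meson
  define P Q where "P = fst L" and "Q = snd L"
  have PQ: "norm P = 1" "norm Q = 1" using L by (auto simp: P_def Q_def)
  have M: "(\<lambda>n. sgn (A (r n))) \<longlonglongrightarrow> P" and N: "(\<lambda>n. sgn (B (r n))) \<longlonglongrightarrow> Q"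
    using tendsto_fst[OF lim] tendsto_snd[OF lim] by (simp_all add: P_def Q_def comp_def)
  define f where "f n = act ((g \<circ> r) n)" for n
  define h where "h n = act (inv\<^bsub>PSL3\<^esub> ((g \<circ> r) n))" for n
  have f_eq: "f n = act (SL3_center #>\<^bsub>SL3\<^esub> A (r n))"
    and h_eq: "h n = act (SL3_center #>\<^bsub>SL3\<^esub> B (r n))" for n
    by (simp add: f_def A(2), simp add: h_def inv_g)
  have f: "induced_by f (\<lambda>n. sgn (A (r n)))" and h: "induced_by h (\<lambda>n. sgn (B (r n)))"
    unfolding f_eq[abs_def] h_eq[abs_def] by (intro induced_by_act_coset A(1) B(1))+
  have hf: "h n (act ((g \<circ> r) n) x) = x" and fh: "act ((g \<circ> r) n) (h n x) = x" for n x
    by (simp_all add: h_eq A B act_inverse)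
  \<comment> \<open>The product of the normalized matrices is the identity divided by this quantity,
    so it vanishes in the limit.\<close>
  have "filterlim (\<lambda>n. norm (A n) * norm (B n)) at_top sequentially"
    using normA normB by (rule filterlim_at_top_mult_at_top)
  then have "(\<lambda>n. inverse (norm (A n) * norm (B n))) \<longlonglongrightarrow> 0"
    by (rule tendsto_inverse_0_at_top)
  then have "(\<lambda>n. inverse (norm (A (r n)) * norm (B (r n)))) \<longlonglongrightarrow> 0"
    using filterlim_subseq[OF r] by (rule filterlim_compose)
  then have "(\<lambda>n. inverse (norm (A (r n)) * norm (B (r n))) *\<^sub>R (mat 1 :: complex^3^3)) \<longlonglongrightarrow> 0 *\<^sub>R mat 1"
    by (intro tendsto_scaleR tendsto_const)
  then have lim0: "(\<lambda>n. inverse (norm (A (r n)) * norm (B (r n))) *\<^sub>R (mat 1 :: complex^3^3)) \<longlonglongrightarrow> 0"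
    by simp
  have prod: "sgn X ** sgn Y = inverse (norm X * norm Y) *\<^sub>R (X ** Y)" for X Y :: "complex^3^3"
    by (simp add: sgn_div_norm scalar_matrix_assoc[symmetric] matrix_scalar_ac mult.commute)
  have PQ0: "P ** Q = 0"
    using LIMSEQ_unique[OF tendsto_matrix_matrix_mult[OF M N]] lim0 by (simp add: prod B)
  have QP0: "Q ** P = 0"
    using LIMSEQ_unique[OF tendsto_matrix_matrix_mult[OF N M]] lim0 by (simp add: prod B mult.commute)
  let ?p = "vec.dim (range ((*v) P))" and ?q = "vec.dim (range ((*v) Q))"
  have range_pos: "vec.dim (range ((*v) X)) \<noteq> 0" if "norm X = 1" for X :: "complex^3^3"
  proof
    assume "vec.dim (range ((*v) X)) = 0"
    then have "X *v v = 0" for v by auto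
    then have "X = 0" by (simp add: matrix_eq)
    with that show False by simp
  qed
  have nullity: "vec.dim {v. P *v v = 0} + ?p = 3" "vec.dim {v. Q *v v = 0} + ?q = 3"
    using vec_rank_nullity[of P] vec_rank_nullity[of Q] by simp_all
  \<comment> \<open>Since \<open>P ** Q = 0\<close>, the range of \<open>Q\<close> lies in the
    kernel of \<open>P\<close>; the ranks then add up to at most 3.\<close>
  have "?q \<le> vec.dim {v. P *v v = 0}"
    using PQ0 by (intro vec.dim_subset) (auto simp: matrix_vector_mul_assoc)
  with nullity range_pos[OF PQ(1)] range_pos[OF PQ(2)]
  have "?p = 1 \<and> ?q = 1 \<or> ?p = 2 \<and> ?q = 1 \<or> ?p = 1 \<and> ?q = 2"
    by linarith
  then consider "?p = 1" "?q = 1" | "?p = 2" "?q = 1" | "?p = 1" "?q = 2" by blast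
  then have "full_flag_case (g \<circ> r) \<or> point_to_line_case (g \<circ> r) \<or> line_to_point_case (g \<circ> r)"
  proof cases
    case 1
    let ?lp = "projectivization {v. P *v v = 0}" and ?lm = "projectivization {v. Q *v v = 0}"
    obtain pp where pp: "projectivization (range ((*v) Q)) = {pp}"
      using projectivization_dim_1[OF subspace_range 1(2)] by blast
    obtain pm where pm: "projectivization (range ((*v) P)) = {pm}"
      using projectivization_dim_1[OF subspace_range 1(1)] by blast
    have ker: "vec.dim {v. P *v v = 0} = 2" "vec.dim {v. Q *v v = 0} = 2" using nullity 1 by simp_all
    then have "projective_line ?lp" "projective_line ?lm"
      using subspace_ker unfolding projective_line_def by blast+
    \<comment> \<open>These inclusions are the flag incidences: \<open>pp\<close> lies on
      \<open>?lp\<close> and \<open>pm\<close> on \<open>?lm\<close>.\<close>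
    moreover have "projectivization (range ((*v) Q)) \<subseteq> ?lp" "projectivization (range ((*v) P)) \<subseteq> ?lm"
      using PQ0 QP0 by (auto simp: projectivization_def matrix_vector_mul_assoc)
    ultimately have "full_flag pp ?lp" "full_flag pm ?lm" by (simp_all add: full_flag_def pp pm)
    moreover have "locally_uniform_limit (- ?lp) f (\<lambda>_. pm)" "locally_uniform_limit (- ?lm) h (\<lambda>_. pp)"
      by (rule locally_uniform_limit_constant[OF f M pm] locally_uniform_limit_constant[OF h N pp])+
    moreover have "destinations (g \<circ> r) x = ?lm" if "x \<in> ?lp - {pp}" for x
      using destinations_of_flag[OF f[unfolded f_def[abs_def]] M h N hf fh PQ0 QP0 ker(1) pm pp] that by blast
    ultimately have "full_flag_case (g \<circ> r)"
      unfolding full_flag_case_def f_def[abs_def] h_def[abs_def] by blast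
    then show ?thesis by blast
  next
    case 2
    then have "point_to_line_case (g \<circ> r)"
      using rank_2_limit[OF f M h N PQ0 QP0]
      unfolding point_to_line_case_def f_def[abs_def] h_def[abs_def] by blast
    then show ?thesis by blast
  next
    case 3
    then have "line_to_point_case (g \<circ> r)"
      using rank_2_limit[OF h N f M QP0 PQ0]
      unfolding line_to_point_case_def f_def[abs_def] h_def[abs_def] by blast
    then show ?thesis by blast
  qed
  with r show ?thesis by blast
qed

theorem theorem1:
  fixes G :: "(complex^3^3) set set" and g :: "nat \<Rightarrow> (complex^3^3) set"
  assumes "discrete_subgroup_PSL3 G"
    and "\<And>n. g n \<in> G"
    and "\<And>m n. m \<noteq> n \<Longrightarrow> g m \<noteq> g n"
  shows "\<exists>r. strict_mono r \<and>
    ((full_flag_case (g \<circ> r) \<and> \<not> point_to_line_case (g \<circ> r) \<and> \<not> line_to_point_case (g \<circ> r)) \<or>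
     (\<not> full_flag_case (g \<circ> r) \<and> point_to_line_case (g \<circ> r) \<and> \<not> line_to_point_case (g \<circ> r)) \<or>
     (\<not> full_flag_case (g \<circ> r) \<and> \<not> point_to_line_case (g \<circ> r) \<and> line_to_point_case (g \<circ> r)))"
proof -
  have "inj g" using assms(3) by (meson injI)
  from discrete_sequence_trichotomy[OF assms(1,2) this] show ?thesis
    using full_flag_not_point_to_line full_flag_not_line_to_point point_to_line_not_line_to_point
    by metis
qed

end
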